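(* Let $J\subset\mathbb{CP}^2$ be the Julia set of the deltoid map $f([x:y:z])=[y^2-2xz:x^2-2yz:z^2]$. (1) Let $L\neq L_\infty$ be a complex line through $[1:0:0]$ (that is, a line parallel to the $x$-axis in $\mathbb{C}^2$). Then $J\cap L$, regarded as a subset of $\mathbb{E}^2$ by means of the similarity $\mathrm{pr}_{\mathbb{E}^2}|_L:L\cap\mathbb{C}^2\to\mathbb{E}^2$, is the pedal curve of the real deltoid with respect to the point $L\cap\mathbb{E}^2$. That is, $J\cap L\subset\mathbb{C}^2$ and $\mathrm{pr}_{\mathbb{E}^2}(J\cap L)$ equals this pedal curve. (2) Likewise, let $L\ne L_\infty$ be a complex line through $[0:1:0]$ (that is, a line parallel to the $y$-axis in $\mathbb{C}^2$). Then $J\cap L$, regarded as a subset of $\mathbb{E}^2$ by means of the similarity $\mathrm{pr}_{\mathbb{E}^2}|_L:L\cap\mathbb{C}^2\to\mathbb{E}^2$, is the pedal curve of the real deltoid with respect to the point $L\cap\mathbb{E}^2$. That is, $J\cap L\subset\mathbb{C}^2$ and $\mathrm{pr}_{\mathbb{E}^2}(J\cap L)$ equals this pedal curve.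
   Context: $\mathbb{C}^2$ is embedded in $\mathbb{CP}^2$ by $(x,y)\mapsto[x:y:1]$, and $L_\infty=\{z=0\}$ is the line at infinity. Julia set: the Fatou set $\Omega$ of $f$ is the largest open subset of $\mathbb{CP}^2$ on which the iterates $\{f^n\}_{n\ge0}$ locally form an equicontinuous family (for a metric inducing the topology of $\mathbb{CP}^2$), and $J=\mathbb{CP}^2\setminus\Omega$. Euclidean plane: $\mathbb{E}^2=\{(x,y)\in\mathbb{C}^2: y=\bar x\}$, a copy of the Euclidean plane, with the metric induced by the standard Hermitian inner product on $\mathbb{C}^2$; the coordinate $x$ identifies it with $\mathbb{C}$ (up to scaling the metric). A line parallel to the $x$-axis or to the $y$-axis meets $\mathbb{E}^2$ in exactly one point. Projection: $\mathrm{pr}_{\mathbb{E}^2}:\mathbb{C}^2\to\mathbb{E}^2$, $\mathrm{pr}_{\mathbb{E}^2}(x,y)=\left(\frac{x+\bar y}{2},\frac{y+\bar x}{2}\right)$. Its restriction to any complex line in $\mathbb{C}^2$ parallel to the $x$-axis or the $y$-axis is a bijective similarity onto $\mathbb{E}^2$. Real deltoid: the curve in $\mathbb{E}^2$ parametrized by $x=2t+\bar t^{\,2}$, $|t|=1$. Its tangent line at the parameter $t$ (including at the three cusps $t^3=1$) is the real line $\{(x,\bar x)\in\mathbb{E}^2: t^3-t^2x+t\bar x-1=0\}$. Pedal curve: given a curve $C$ and a point $O$ in $\mathbb{E}^2$, the pedal curve of $C$ with respect to $O$ is the locus of points $P$ such that $P$ is the orthogonal projection of $O$ onto a line tangent to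 $C$. *)

theory Defs
  imports "HOL-Analysis.Analysis" "HOL-Library.Landau_Symbols"
begin

section \<open>The complex projective plane\<close>

quotient_type cp2 = "complex^3" / partial:
  "\<lambda>v w. v \<noteq> 0 \<and> w \<noteq> 0 \<and> (\<exists>c. w = c *s v)"
proof (rule part_equivpI)
  show "\<exists>v::complex^3. v \<noteq> 0 \<and> v \<noteq> 0 \<and> (\<exists>c. v = c *s v)"
    by (rule exI[of _ "axis 1 1"]) (auto simp: axis_eq_0_iff intro: exI[of _ 1])
next
  show "symp (\<lambda>v w::complex^3. v \<noteq> 0 \<and> w \<noteq> 0 \<and> (\<exists>c. w = c *s v))"
  proof (rule sympI)
    fix v w :: "complex^3"
    assume vw: "v \<noteq> 0 \<and> w \<noteq> 0 \<and> (\<exists>c. w = c *s v)"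
    then obtain c where c: "w = c *s v" by blast
    with vw have "c \<noteq> 0" by auto
    with c have "v = inverse c *s w" by (simp add: vector_smult_assoc)
    with vw show "w \<noteq> 0 \<and> v \<noteq> 0 \<and> (\<exists>c. v = c *s w)" by blast
  qed
next
  show "transp (\<lambda>v w::complex^3. v \<noteq> 0 \<and> w \<noteq> 0 \<and> (\<exists>c. w = c *s v))"
    by (rule transpI) (auto simp: vector_smult_assoc)
qed

text \<open>A point \<open>[v]\<close> is identified with the orthogonal projector \<open>v v\<^sup>* / |v|\<^sup>2\<close> onto the complex line
  spanned by \<open>v\<close>; the distance is the Frobenius distance of the projectors. The lemma
  \<open>open_cp2_iff\<close> below shows that this induces the quotient topology.\<close>

lift_definition projector :: "cp2 \<Rightarrow> complex^3^3" is
  "\<lambda>v. \<chi> i j. v $ i * cnj (v $ j) / complex_of_real ((norm v)\<^sup>2)"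
proof -
  fix v w :: "complex^3"
  assume "v \<noteq> 0 \<and> w \<noteq> 0 \<and> (\<exists>c. w = c *s v)"
  then obtain c where c: "w = c *s v" "w \<noteq> 0" by blast
  then have "c \<noteq> 0" by auto
  have "norm w = cmod c * norm v"
    unfolding c norm_vec_def by (simp add: norm_mult L2_set_right_distrib)
  then have n: "complex_of_real ((norm w)\<^sup>2) = c * cnj c * complex_of_real ((norm v)\<^sup>2)"
    by (simp add: power_mult_distrib complex_mult_cnj cmod_power2)
  show "(\<chi> i j. v $ i * cnj (v $ j) / complex_of_real ((norm v)\<^sup>2)) =
        (\<chi> i j. w $ i * cnj (w $ j) / complex_of_real ((norm w)\<^sup>2))"
    unfolding n using \<open>c \<noteq> 0\<close> by (simp add: c vec_eq_iff)
qed

lemma abs_cp2_eq_iff: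
  assumes "v \<noteq> 0" "w \<noteq> 0"
  shows "abs_cp2 v = abs_cp2 w \<longleftrightarrow> (\<exists>c. w = c *s v)"
proof -
  have "\<exists>c. u = c *s u" for u :: "complex^3" by (rule exI[of _ 1]) simp
  then show ?thesis
    using Quotient3_rel[OF Quotient3_cp2, of v w] assms by simp
qed

lemma cp2_cases: obtains v where "v \<noteq> 0" "p = abs_cp2 v"
proof -
  have "rep_cp2 p \<noteq> 0" using Quotient3_rep_reflp[OF Quotient3_cp2, of p] by simp
  moreover have "p = abs_cp2 (rep_cp2 p)" by (simp add: Quotient3_abs_rep[OF Quotient3_cp2])
  ultimately show thesis using that by blast
qed

lemma projector_abs:
  assumes "v \<noteq> 0"
  shows "projector (abs_cp2 v) = (\<chi> i j. v $ i * cnj (v $ j) / complex_of_real ((norm v)\<^sup>2))"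
  using assms by (intro projector.abs_eq) (auto intro: exI[of _ 1])

lemma projector_mult:
  assumes "v \<noteq> 0"
  shows "projector (abs_cp2 v) *v u =
    ((\<Sum>j\<in>UNIV. cnj (v $ j) * u $ j) / complex_of_real ((norm v)\<^sup>2)) *s v"
  unfolding projector_abs[OF assms]
  by (simp add: matrix_vector_mult_def vec_eq_iff sum_distrib_left sum_distrib_right sum_divide_distrib mult_ac)

lemma projector_self:
  assumes "v \<noteq> 0"
  shows "projector (abs_cp2 v) *v v = v"
proof -
  have "(\<Sum>j\<in>UNIV. cnj (v $ j) * v $ j) = complex_of_real ((norm v)\<^sup>2)"
    by (simp add: norm_vec_def L2_set_def sum_nonneg complex_norm_square[symmetric] mult.commute)
  then show ?thesis using assms by (simp add: projector_mult)
qed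

lemma inj_projector: "inj projector"
proof (rule injI)
  fix p q assume eq: "projector p = projector q"
  obtain v w where v: "v \<noteq> 0" "p = abs_cp2 v" and w: "w \<noteq> 0" "q = abs_cp2 w"
    by (metis cp2_cases)
  have "w = projector (abs_cp2 v) *v w" using eq v w projector_self by simp
  then have "\<exists>c. w = c *s v" using projector_mult[OF v(1)] by metis
  then show "p = q" using v w abs_cp2_eq_iff by simp
qed

instantiation cp2 :: metric_space
begin

definition dist_cp2 :: "cp2 \<Rightarrow> cp2 \<Rightarrow> real" where
  "dist_cp2 p q = dist (projector p) (projector q)"

definition uniformity_cp2 :: "(cp2 \<times> cp2) filter" where
  "uniformity_cp2 = (INF e\<in>{0<..}. principal {(x, y). dist x y < e})"

definition open_cp2 :: "cp2 set \<Rightarrow> bool" where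
  "open_cp2 U = (\<forall>x\<in>U. eventually (\<lambda>(x', y). x' = x \<longrightarrow> y \<in> U) uniformity)"

instance
proof
  show "dist p q = 0 \<longleftrightarrow> p = q" for p q :: cp2
    using inj_projector by (auto simp: dist_cp2_def inj_def)
  show "dist p q \<le> dist p r + dist q r" for p q r :: cp2
    unfolding dist_cp2_def by (rule dist_triangle2)
qed (rule uniformity_cp2_def open_cp2_def)+

end

lemma open_cp2_iff:
  fixes U :: "cp2 set"
  shows "open U \<longleftrightarrow> open {v. v \<noteq> 0 \<and> abs_cp2 v \<in> U}"
proof
  assume U: "open U"
  let ?P = "\<lambda>v::complex^3. \<chi> i j. v $ i * cnj (v $ j) / complex_of_real ((norm v)\<^sup>2)"
  have cont: "continuous_on (-{0}) ?P"
    by (intro continuous_on_vec_lambda continuous_on_divide continuous_on_mult continuous_on_cnj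
        continuous_on_of_real continuous_on_power continuous_on_norm continuous_on_id
        continuous_on_component) simp
  have "continuous_on (-{0}) abs_cp2"
    unfolding continuous_on_iff
  proof (intro ballI allI impI)
    fix v :: "complex^3" and e :: real
    assume v: "v \<in> -{0}" and e: "e > 0"
    have "\<exists>d>0. \<forall>w\<in>-{0}. dist w v < d \<longrightarrow> dist (?P w) (?P v) < e"
      by (rule cont[unfolded continuous_on_iff, rule_format, OF v e])
    then obtain d where d: "d > 0" "\<And>w. w \<in> -{0} \<Longrightarrow> dist w v < d \<Longrightarrow> dist (?P w) (?P v) < e"
      by blast
    have "dist (abs_cp2 w) (abs_cp2 v) = dist (?P w) (?P v)" if "w \<in> -{0}" for w
      using that v by (simp only: dist_cp2_def projector_abs Compl_iff singleton_iff not_False_eq_True)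
    with d show "\<exists>d>0. \<forall>w\<in>-{0}. dist w v < d \<longrightarrow> dist (abs_cp2 w) (abs_cp2 v) < e"
      by metis
  qed
  then have "open (-{0} \<inter> abs_cp2 -` U)"
    using U by (intro continuous_open_preimage) auto
  moreover have "-{0} \<inter> abs_cp2 -` U = {v. v \<noteq> 0 \<and> abs_cp2 v \<in> U}" by auto
  ultimately show "open {v. v \<noteq> 0 \<and> abs_cp2 v \<in> U}" by simp
next
  assume V: "open {v. v \<noteq> 0 \<and> abs_cp2 v \<in> U}" (is "open ?V")
  show "open U"
    unfolding open_dist
  proof
    fix p assume "p \<in> U"
    obtain v where v: "v \<noteq> 0" "p = abs_cp2 v" by (rule cp2_cases)
    have cont: "continuous_on UNIV (\<lambda>A::complex^3^3. A *v v)"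
      unfolding matrix_vector_mult_def
      by (intro continuous_on_vec_lambda continuous_on_sum continuous_on_mult
          continuous_on_component continuous_on_id continuous_on_const)
    have "open ((\<lambda>A::complex^3^3. A *v v) -` ?V)"
      using V cont by (rule open_vimage)
    moreover have "projector p \<in> (\<lambda>A::complex^3^3. A *v v) -` ?V"
      using \<open>p \<in> U\<close> v by (simp add: projector_self)
    ultimately obtain e where e: "e > 0"
      "\<And>A. dist A (projector p) < e \<Longrightarrow> A *v v \<in> ?V"
      unfolding open_dist by blast
    have "q \<in> U" if q: "dist q p < e" for q
    proof -
      obtain w where w: "w \<noteq> 0" "q = abs_cp2 w" by (rule cp2_cases)
      have *: "projector q *v v \<in> ?V" using e(2) q by (simp add: dist_cp2_def)
      moreover have "\<exists>c. projector q *v v = c *s w" using projector_mult[OF w(1)] w(2) by blast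
      ultimately have "q = abs_cp2 (projector q *v v)"
        using abs_cp2_eq_iff[OF w(1)] w(2) by blast
      moreover have "abs_cp2 (projector q *v v) \<in> U" using * by blast
      ultimately show ?thesis by (rule ssubst)
    qed
    then show "\<exists>e>0. \<forall>q. dist q p < e \<longrightarrow> q \<in> U" using e(1) by blast
  qed
qed

definition proj_point :: "complex \<Rightarrow> complex \<Rightarrow> complex \<Rightarrow> cp2" where
  "proj_point x y z = abs_cp2 (vector [x, y, z])"

definition affine_embedding :: "complex \<times> complex \<Rightarrow> cp2" where
  "affine_embedding = (\<lambda>(x, y). proj_point x y 1)"

definition proj_line :: "complex \<Rightarrow> complex \<Rightarrow> complex \<Rightarrow> cp2 set" where
  "proj_line a b c = {proj_point x y z | x y z. (x, y, z) \<noteq> (0, 0, 0) \<and> a * x + b * y + c * z = 0}"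

definition complex_line :: "cp2 set \<Rightarrow> bool" where
  "complex_line L \<longleftrightarrow> (\<exists>a b c. (a, b, c) \<noteq> (0, 0, 0) \<and> L = proj_line a b c)"

definition line_at_infinity :: "cp2 set" where
  "line_at_infinity = proj_line 0 0 1"


section \<open>Fatou and Julia sets\<close>

definition equicontinuous_on :: "'a::metric_space set \<Rightarrow> ('a \<Rightarrow> 'b::metric_space) set \<Rightarrow> bool" where
  "equicontinuous_on S F \<longleftrightarrow>
    (\<forall>x\<in>S. \<forall>e>0. \<exists>d>0. \<forall>g\<in>F. \<forall>y\<in>S. dist y x < d \<longrightarrow> dist (g y) (g x) < e)"

definition locally_equicontinuous_on :: "'a::metric_space set \<Rightarrow> ('a \<Rightarrow> 'b::metric_space) set \<Rightarrow> bool" where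
  "locally_equicontinuous_on U F \<longleftrightarrow>
    (\<forall>x\<in>U. \<exists>V. open V \<and> x \<in> V \<and> V \<subseteq> U \<and> equicontinuous_on V F)"

definition fatou_set :: "('a::metric_space \<Rightarrow> 'a) \<Rightarrow> 'a set" where
  "fatou_set f = \<Union>{U. open U \<and> locally_equicontinuous_on U (range (\<lambda>n. f ^^ n))}"

definition julia_set :: "('a::metric_space \<Rightarrow> 'a) \<Rightarrow> 'a set" where
  "julia_set f = - fatou_set f"

lemma fatou_set_is_largest:
  shows "open (fatou_set f)"
    and "locally_equicontinuous_on (fatou_set f) (range (\<lambda>n. f ^^ n))"
    and "open U \<Longrightarrow> locally_equicontinuous_on U (range (\<lambda>n. f ^^ n)) \<Longrightarrow> U \<subseteq> fatou_set f"
proof -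
  show "open (fatou_set f)" unfolding fatou_set_def by auto
  show "locally_equicontinuous_on (fatou_set f) (range (\<lambda>n. f ^^ n))"
    unfolding locally_equicontinuous_on_def
  proof
    fix x assume "x \<in> fatou_set f"
    then obtain U where U: "x \<in> U" "open U" "locally_equicontinuous_on U (range (\<lambda>n. f ^^ n))"
      unfolding fatou_set_def by blast
    then obtain V where "open V" "x \<in> V" "V \<subseteq> U" "equicontinuous_on V (range (\<lambda>n. f ^^ n))"
      unfolding locally_equicontinuous_on_def by blast
    moreover have "U \<subseteq> fatou_set f" using U unfolding fatou_set_def by blast
    ultimately show "\<exists>V. open V \<and> x \<in> V \<and> V \<subseteq> fatou_set f \<and> equicontinuous_on V (range (\<lambda>n. f ^^ n))"
      by blast
  qed
  show "open U \<Longrightarrow> locally_equicontinuous_on U (range (\<lambda>n. f ^^ n)) \<Longrightarrow> U \<subseteq> fatou_set f"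
    unfolding fatou_set_def by blast
qed

lift_definition deltoid_map :: "cp2 \<Rightarrow> cp2" is
  "\<lambda>v. vector [(v $ 2)\<^sup>2 - 2 * v $ 1 * v $ 3, (v $ 1)\<^sup>2 - 2 * v $ 2 * v $ 3, (v $ 3)\<^sup>2]"
proof -
  let ?f = "\<lambda>v::complex^3. vector [(v $ 2)\<^sup>2 - 2 * v $ 1 * v $ 3, (v $ 1)\<^sup>2 - 2 * v $ 2 * v $ 3, (v $ 3)\<^sup>2] :: complex^3"
  have nz: "?f v \<noteq> 0" if "v \<noteq> 0" for v
    using that by (auto simp: vec_eq_iff forall_3)
  fix v w :: "complex^3"
  assume A: "v \<noteq> 0 \<and> w \<noteq> 0 \<and> (\<exists>c. w = c *s v)"
  then obtain c where "w = c *s v" by blast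
  then have "?f w = c\<^sup>2 *s ?f v"
    by (simp add: vec_eq_iff forall_3 power2_eq_square algebra_simps)
  with A nz show "?f v \<noteq> 0 \<and> ?f w \<noteq> 0 \<and> (\<exists>c. ?f w = c *s ?f v)" by blast
qed

lemma deltoid_map_proj_point:
  assumes "(x, y, z) \<noteq> (0, 0, 0)"
  shows "deltoid_map (proj_point x y z) = proj_point (y\<^sup>2 - 2 * x * z) (x\<^sup>2 - 2 * y * z) (z\<^sup>2)"
proof -
  have "vector [x, y, z] \<noteq> (0 :: complex^3)" using assms by (auto simp: vec_eq_iff forall_3)
  then show ?thesis
    unfolding proj_point_def by (subst deltoid_map.abs_eq) (auto intro: exI[of _ 1])
qed


section \<open>The Euclidean plane and pedal curves\<close>

definition euclidean_plane :: "(complex \<times> complex) set" where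
  "euclidean_plane = {(x, y). y = cnj x}"

definition pr_plane :: "complex \<times> complex \<Rightarrow> complex \<times> complex" where
  "pr_plane = (\<lambda>(x, y). ((x + cnj y) / 2, (y + cnj x) / 2))"

text \<open>A real line \<open>L\<close> through \<open>\<gamma> s\<close> is tangent at the parameter \<open>s\<close> if the distance from \<open>\<gamma> r\<close> to \<open>L\<close> is
  negligible compared with the distance from \<open>\<gamma> r\<close> to \<open>\<gamma> s\<close>, i.e. the secants converge to \<open>L\<close>.
  This makes sense at cusps as well.\<close>

definition tangent_line ::
  "('p::topological_space \<Rightarrow> 'a::real_normed_vector) \<Rightarrow> 'p set \<Rightarrow> 'p \<Rightarrow> 'a set \<Rightarrow> bool" where
  "tangent_line \<gamma> S s L \<longleftrightarrow>
    (\<exists>v. v \<noteq> 0 \<and> L = range (\<lambda>r::real. \<gamma> s + r *\<^sub>R v)) \<and>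
    (\<lambda>r. infdist (\<gamma> r) L) \<in> o[at s within S](\<lambda>r. dist (\<gamma> r) (\<gamma> s))"

definition orthogonal_foot :: "'a::real_inner \<Rightarrow> 'a set \<Rightarrow> 'a \<Rightarrow> bool" where
  "orthogonal_foot pt L P \<longleftrightarrow> P \<in> L \<and> (\<forall>Q\<in>L. orthogonal (pt - P) (Q - P))"

definition pedal_curve ::
  "('p::topological_space \<Rightarrow> 'a::real_inner) \<Rightarrow> 'p set \<Rightarrow> 'a \<Rightarrow> 'a set" where
  "pedal_curve \<gamma> S pt = {P. \<exists>s\<in>S. \<exists>L. tangent_line \<gamma> S s L \<and> orthogonal_foot pt L P}"

definition deltoid :: "complex \<Rightarrow> complex \<times> complex" where
  "deltoid t = (2 * t + (cnj t)\<^sup>2, cnj (2 * t + (cnj t)\<^sup>2))"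

lemma tangent_line_unique:
  fixes \<gamma> :: "'p::topological_space \<Rightarrow> 'a::euclidean_space"
  assumes L: "tangent_line \<gamma> S s L" and M: "tangent_line \<gamma> S s M"
    and nontriv: "at s within S \<noteq> bot" and ne: "eventually (\<lambda>r. \<gamma> r \<noteq> \<gamma> s) (at s within S)"
  shows "L = M"
proof -
  obtain v where v: "v \<noteq> 0" "L = range (\<lambda>r::real. \<gamma> s + r *\<^sub>R v)"
    using L unfolding tangent_line_def by blast
  obtain w where w: "w \<noteq> 0" "M = range (\<lambda>r::real. \<gamma> s + r *\<^sub>R w)"
    using M unfolding tangent_line_def by blast
  have close: "\<exists>k. norm (v - k *\<^sub>R w) \<le> 4 * e * norm v" if e: "0 < e" "e < 1/2" for e
  proof -
    have "eventually (\<lambda>r. \<gamma> r \<noteq> \<gamma> s \<and> infdist (\<gamma> r) L \<le> e/2 * dist (\<gamma> r) (\<gamma> s) \<and>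
        infdist (\<gamma> r) M \<le> e/2 * dist (\<gamma> r) (\<gamma> s)) (at s within S)"
      using landau_o.smallD[of _ _ _ "e/2"] L M e ne
      unfolding tangent_line_def by (intro eventually_conj) (force simp: infdist_nonneg)+
    then obtain r where r: "\<gamma> r \<noteq> \<gamma> s" "infdist (\<gamma> r) L \<le> e/2 * dist (\<gamma> r) (\<gamma> s)"
        "infdist (\<gamma> r) M \<le> e/2 * dist (\<gamma> r) (\<gamma> s)"
      using eventually_happens'[OF nontriv] by blast
    define D where "D = dist (\<gamma> r) (\<gamma> s)"
    have D: "D > 0" using r(1) by (simp add: D_def)
    have lt: "e/2 * D < e * D" using D e by simp
    have "L \<noteq> {}" "M \<noteq> {}" using v w by auto
    moreover have "\<exists>a\<in>A. dist (\<gamma> r) a < e * D"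
      if "A \<noteq> {}" "infdist (\<gamma> r) A \<le> e/2 * D" for A
    proof -
      have "(INF a\<in>A. dist (\<gamma> r) a) < e * D"
        using that(2) lt unfolding infdist_notempty[OF that(1)] by linarith
      then show ?thesis using that(1) by (subst (asm) cINF_less_iff) auto
    qed
    ultimately obtain a b where a: "a \<in> L" "dist (\<gamma> r) a < e * D" and b: "b \<in> M" "dist (\<gamma> r) b < e * D"
      using r(2,3) unfolding D_def by meson
    obtain i where i: "a = \<gamma> s + i *\<^sub>R v" using a v by blast
    obtain j where j: "b = \<gamma> s + j *\<^sub>R w" using b w by blast
    have ab: "norm (i *\<^sub>R v - j *\<^sub>R w) \<le> 2 * e * D"
      using dist_triangle3[of a b "\<gamma> r"] a b by (simp add: i j dist_norm)
    have "D \<le> norm (i *\<^sub>R v) + e * D"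
      using dist_triangle[of "\<gamma> r" "\<gamma> s" a] a by (simp add: i dist_norm D_def)
    moreover have "e * D \<le> D / 2" using e D by (simp add: mult.commute)
    ultimately have iv: "D \<le> 2 * (\<bar>i\<bar> * norm v)" by simp
    then have i0: "i \<noteq> 0" using D by auto
    have "\<bar>i\<bar> * norm (v - (j / i) *\<^sub>R w) = norm (i *\<^sub>R v - j *\<^sub>R w)"
      using i0 by (simp add: scaleR_diff_right flip: norm_scaleR)
    also have "\<dots> \<le> \<bar>i\<bar> * (4 * e * norm v)"
      using order_trans[OF ab mult_left_mono[OF iv, of "2 * e"]] e by (simp add: mult_ac)
    finally have "norm (v - (j / i) *\<^sub>R w) \<le> 4 * e * norm v" using i0 by simp
    then show ?thesis by blast
  qed
  have "v \<in> closure (span {w})"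
    unfolding closure_approachable
  proof (intro allI impI)
    fix e :: real assume "e > 0"
    define d where "d = min (1/4) (e / (8 * norm v))"
    have d: "0 < d" "d < 1/2" "d \<le> e / (8 * norm v)" using v \<open>e > 0\<close> by (auto simp: d_def)
    then have "4 * d * norm v \<le> e / 2" using v by (simp add: field_simps)
    moreover obtain k where "norm (v - k *\<^sub>R w) \<le> 4 * d * norm v" using close d by blast
    ultimately have "norm (v - k *\<^sub>R w) < e" using \<open>e > 0\<close> by simp
    then show "\<exists>y\<in>span {w}. dist y v < e"
      by (intro bexI[of _ "k *\<^sub>R w"]) (auto simp: dist_norm norm_minus_commute span_singleton)
  qed
  then have "v \<in> span {w}" by (simp add: closure_closed closed_span)
  then obtain k where k: "v = k *\<^sub>R w" by (auto simp: span_singleton)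
  then have k0: "k \<noteq> 0" using v by auto
  have "L \<subseteq> M"
  proof
    fix z assume "z \<in> L"
    then obtain r where "z = \<gamma> s + r *\<^sub>R v" using v by blast
    then have "z = \<gamma> s + (r * k) *\<^sub>R w" by (simp add: k)
    then show "z \<in> M" using w by blast
  qed
  moreover have "M \<subseteq> L"
  proof
    fix z assume "z \<in> M"
    then obtain r where "z = \<gamma> s + r *\<^sub>R w" using w by blast
    then have "z = \<gamma> s + (r / k) *\<^sub>R v" using k0 by (simp add: k)
    then show "z \<in> L" using v by blast
  qed
  ultimately show ?thesis by blast
qed

text \<open>The tangent lines of the deltoid, including those at the three cusps \<open>t\<^sup>3 = 1\<close>.\<close>

lemma tangent_line_deltoid:
  assumes t: "t \<in> sphere 0 1"
  shows "tangent_line deltoid (sphere 0 1) t L \<longleftrightarrow>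
    L = {(x, cnj x) | x. t ^ 3 - t\<^sup>2 * x + t * cnj x - 1 = 0}"
proof -
  define T where "T = {(x, cnj x) | x. t ^ 3 - t\<^sup>2 * x + t * cnj x - 1 = 0}"
  have circ: "u * cnj u = 1" if "u \<in> sphere 0 1" for u :: complex
    using that by (simp add: complex_norm_square[symmetric])
  have t1: "t * cnj t = 1" "t \<noteq> 0" using circ[OF t] t by auto
  have dist2: "dist (x, cnj x) (y, cnj y) = sqrt 2 * cmod (x - y)" for x y
  proof -
    have "dist (cnj x) (cnj y) = cmod (x - y)" by (metis complex_cnj_diff complex_mod_cnj dist_norm)
    then show ?thesis unfolding dist_Pair_Pair dist_norm[of x]
      by (simp add: real_sqrt_mult flip: mult_2)
  qed

  define s where "s = csqrt t"
  have s2: "s\<^sup>2 = t" by (simp add: s_def)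
  have s1: "s * cnj s = 1"
  proof -
    have "cmod s ^ 2 = 1" using t s2 by (metis dist_0_norm mem_sphere norm_power)
    then show ?thesis by (simp flip: complex_norm_square)
  qed
  define p where "p t = 2 * t + (cnj t)\<^sup>2" for t :: complex
  have line: "T = range (\<lambda>r::real. deltoid t + r *\<^sub>R (cnj s, s))"
  proof (intro set_eqI iffI)
    fix z assume "z \<in> T"
    then obtain x where x: "z = (x, cnj x)" "t ^ 3 - t\<^sup>2 * x + t * cnj x - 1 = 0"
      unfolding T_def by blast
    define y where "y = x - p t"
    have "t\<^sup>2 * y = t * cnj y" using x(2) t1 unfolding y_def p_def
      by (simp add: power2_eq_square power3_eq_cube) algebra
    then have "t * y = cnj y" using t1 by (simp add: power2_eq_square)
    then have "s * y = cnj (s * y)" proof -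
      have "cnj (s * y) = cnj s * (t * y)" using \<open>t * y = cnj y\<close> by simp
      also have "\<dots> = (s * cnj s) * (s * y)" by (simp add: s2[symmetric] power2_eq_square)
      finally show ?thesis using s1 by simp
    qed
    then obtain r where r: "s * y = complex_of_real r" by (metis Reals_cnj_iff Reals_cases)
    have "y = of_real r * cnj s"
    proof -
      have "of_real r * cnj s = (s * cnj s) * y" by (simp flip: r)
      then show ?thesis using s1 by simp
    qed
    then have "z = deltoid t + r *\<^sub>R (cnj s, s)"
      unfolding x deltoid_def by (simp add: y_def p_def scaleR_conv_of_real algebra_simps)
    then show "z \<in> range (\<lambda>r::real. deltoid t + r *\<^sub>R (cnj s, s))" by blast
  next
    fix z assume "z \<in> range (\<lambda>r::real. deltoid t + r *\<^sub>R (cnj s, s))"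
    then obtain r :: real where r: "z = deltoid t + r *\<^sub>R (cnj s, s)" by blast
    define x where "x = p t + of_real r * cnj s"
    have z: "z = (x, cnj x)" unfolding r deltoid_def x_def p_def by (simp add: scaleR_conv_of_real)
    have "t ^ 3 - t\<^sup>2 * x + t * cnj x - 1 = 0"
      using t1 s1 s2 unfolding x_def p_def by simp algebra
    then show "z \<in> T" using z unfolding T_def by blast
  qed

  have incl: "infdist (deltoid u) T \<le> sqrt 2 * (cmod (u - t))\<^sup>2 * cmod (u\<^sup>2 - cnj t)"
    if u: "u \<in> sphere 0 1" for u
  proof -
    have u1: "u * cnj u = 1" using circ u .
    define l where "l = t * (u - t)\<^sup>2 * (u\<^sup>2 - cnj t) * (cnj u)\<^sup>2"
    have l: "t ^ 3 - t\<^sup>2 * p u + t * cnj (p u) - 1 = l"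
      using u1 t1 unfolding p_def l_def by simp algebra
    define q where "q = p u + l * (cnj t)\<^sup>2 / 2"
    have "cnj l = - ((cnj t) ^ 3 * l)"
      using u1 t1 unfolding l_def by simp algebra
    then have "t ^ 3 - t\<^sup>2 * q + t * cnj q - 1 = 0"
      using l t1 unfolding q_def by simp algebra
    then have "(q, cnj q) \<in> T" unfolding T_def by blast
    then have "infdist (deltoid u) T \<le> sqrt 2 * cmod (p u - q)"
      using infdist_le[of "(q, cnj q)" T "deltoid u"] dist2[of "p u" q] by (simp add: deltoid_def p_def)
    also have "cmod (p u - q) = (cmod (u - t))\<^sup>2 * cmod (u\<^sup>2 - cnj t) / 2"
      using t u by (simp add: q_def l_def norm_mult norm_power norm_divide)
    also have "sqrt 2 * \<dots> \<le> sqrt 2 * (cmod (u - t))\<^sup>2 * cmod (u\<^sup>2 - cnj t)" by simp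
    finally show ?thesis .
  qed
  have dd: "dist (deltoid u) (deltoid t) = sqrt 2 * cmod (u - t) * cmod (2 * u\<^sup>2 * t\<^sup>2 - u - t)"
    if u: "u \<in> sphere 0 1" for u
  proof -
    have u1: "u * cnj u = 1" using circ u .
    have "p u - p t = (u - t) * (2 * u\<^sup>2 * t\<^sup>2 - u - t) * (cnj u)\<^sup>2 * (cnj t)\<^sup>2"
      using u1 t1 unfolding p_def by algebra
    then have "cmod (p u - p t) = cmod (u - t) * cmod (2 * u\<^sup>2 * t\<^sup>2 - u - t)"
      using t u by (simp add: norm_mult norm_power)
    then show ?thesis using dist2[of "p u" "p t"] by (simp add: deltoid_def p_def)
  qed

  obtain C where C: "C > 0"
    "eventually (\<lambda>u. cmod (u - t) * cmod (u\<^sup>2 - cnj t) \<le> C * cmod (u - t) * cmod (2 * u\<^sup>2 * t\<^sup>2 - u - t)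
       \<and> 2 * u\<^sup>2 * t\<^sup>2 - u - t \<noteq> 0) (at t within sphere 0 1)"
  proof (cases "t ^ 3 = 1")
    case False
    have lim: "((\<lambda>u. cmod (2 * u\<^sup>2 * t\<^sup>2 - u - t)) \<longlongrightarrow> cmod (2 * t\<^sup>2 * t\<^sup>2 - t - t)) (at t within sphere 0 1)"
      by (intro tendsto_intros)
    have "2 * t\<^sup>2 * t\<^sup>2 - t - t = 2 * t * (t ^ 3 - 1)" by algebra
    then have m: "cmod (2 * t\<^sup>2 * t\<^sup>2 - t - t) = 2 * cmod (t ^ 3 - 1)"
      using t by (simp add: norm_mult)
    have k: "cmod (t ^ 3 - 1) > 0" using False by simp
    have ev: "eventually (\<lambda>u. cmod (2 * u\<^sup>2 * t\<^sup>2 - u - t) > cmod (t ^ 3 - 1)) (at t within sphere 0 1)"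
      using order_tendstoD(1)[OF lim, of "cmod (t ^ 3 - 1)"] k unfolding m by simp
    have bd: "cmod (u\<^sup>2 - cnj t) \<le> 2" if "u \<in> sphere 0 1" for u
      using norm_triangle_ineq4[of "u\<^sup>2" "cnj t"] that t by (simp add: norm_power)
    show ?thesis
    proof (rule that[of "2 / cmod (t ^ 3 - 1)"])
      show "0 < 2 / cmod (t ^ 3 - 1)" using k by simp
      have "eventually (\<lambda>u. u \<in> sphere 0 1) (at t within sphere 0 1)"
        by (simp add: eventually_at_filter)
      with ev show "eventually (\<lambda>u. cmod (u - t) * cmod (u\<^sup>2 - cnj t)
          \<le> 2 / cmod (t ^ 3 - 1) * cmod (u - t) * cmod (2 * u\<^sup>2 * t\<^sup>2 - u - t)
          \<and> 2 * u\<^sup>2 * t\<^sup>2 - u - t \<noteq> 0) (at t within sphere 0 1)"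
      proof eventually_elim
        case (elim u)
        have "cmod (u\<^sup>2 - cnj t) * cmod (t ^ 3 - 1) \<le> 2 * cmod (2 * u\<^sup>2 * t\<^sup>2 - u - t)"
          using mult_mono[OF bd[OF elim(2)] less_imp_le[OF elim(1)]] by simp
        then have "cmod (u\<^sup>2 - cnj t) \<le> 2 / cmod (t ^ 3 - 1) * cmod (2 * u\<^sup>2 * t\<^sup>2 - u - t)"
          using k by (simp add: field_simps)
        from mult_left_mono[OF this, of "cmod (u - t)"] elim(1) k show ?case
          by (auto simp: mult_ac)
      qed
    qed
  next
    case True
    have ct: "cnj t = t\<^sup>2" using True t1 by algebra
    show ?thesis
    proof (rule that[of 2])
      have "eventually (\<lambda>u. u \<in> sphere 0 1 \<and> u \<noteq> t) (at t within sphere 0 1)"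
        by (simp add: eventually_at_filter)
      then show "eventually (\<lambda>u. cmod (u - t) * cmod (u\<^sup>2 - cnj t)
          \<le> 2 * cmod (u - t) * cmod (2 * u\<^sup>2 * t\<^sup>2 - u - t)
          \<and> 2 * u\<^sup>2 * t\<^sup>2 - u - t \<noteq> 0) (at t within sphere 0 1)"
      proof eventually_elim
        case (elim u)
        have "2 * u\<^sup>2 * t\<^sup>2 - u - t = t\<^sup>2 * (2 * u + t) * (u - t)" using True by algebra
        then have a: "cmod (2 * u\<^sup>2 * t\<^sup>2 - u - t) = cmod (2 * u + t) * cmod (u - t)"
          using t by (simp add: norm_mult norm_power)
        have b: "cmod (2 * u + t) \<ge> 1" using norm_triangle_ineq4[of "2 * u + t" t] elim t by (simp add: norm_mult)
        have "u\<^sup>2 - cnj t = (u - t) * (u + t)" unfolding ct by algebra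
        then have c: "cmod (u\<^sup>2 - cnj t) = cmod (u - t) * cmod (u + t)" by (simp add: norm_mult)
        have d: "cmod (u + t) \<le> 2" using norm_triangle_ineq[of u t] elim t by simp
        have "cmod (u + t) \<le> 2 * cmod (2 * u + t)" using b d by simp
        then have "cmod (u\<^sup>2 - cnj t) \<le> 2 * cmod (2 * u\<^sup>2 * t\<^sup>2 - u - t)"
          unfolding a c using mult_left_mono[of _ _ "cmod (u - t)"] by (fastforce simp: mult_ac)
        from mult_left_mono[OF this, of "cmod (u - t)"] a b elim show ?case
          by (auto simp: mult_ac)
      qed
    qed simp
  qed
  have onS: "eventually (\<lambda>u. u \<in> sphere 0 1 \<and> u \<noteq> t) (at t within sphere 0 1)"
    by (simp add: eventually_at_filter)

  have "(\<lambda>u. infdist (deltoid u) T) \<in> o[at t within sphere 0 1](\<lambda>u. dist (deltoid u) (deltoid t))"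
  proof (rule landau_o.smallI)
    fix c :: real assume "c > 0"
    have "((\<lambda>u. cmod (u - t)) \<longlongrightarrow> cmod (t - t)) (at t within sphere 0 1)"
      by (intro tendsto_intros)
    then have "eventually (\<lambda>u. cmod (u - t) < c / C) (at t within sphere 0 1)"
      using order_tendstoD(2)[of _ 0 _ "c / C"] \<open>c > 0\<close> C(1) by simp
    with onS C(2) show "eventually (\<lambda>u. norm (infdist (deltoid u) T) \<le> c * norm (dist (deltoid u) (deltoid t)))
        (at t within sphere 0 1)"
    proof eventually_elim
      case (elim u)
      let ?a = "cmod (u - t)" and ?b = "cmod (2 * u\<^sup>2 * t\<^sup>2 - u - t)"
      have "infdist (deltoid u) T \<le> sqrt 2 * ?a * (?a * cmod (u\<^sup>2 - cnj t))"
        using incl elim(1) by (simp add: power2_eq_square mult_ac)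
      also have "\<dots> \<le> sqrt 2 * ?a * (C * ?a * ?b)"
        using elim(2) by (intro mult_left_mono) auto
      also have "\<dots> = (?a * C) * (sqrt 2 * ?a * ?b)" by simp
      also have "\<dots> \<le> c * (sqrt 2 * ?a * ?b)"
        using elim(3) C(1) by (intro mult_right_mono) (auto simp: field_simps)
      finally show ?case using dd elim(1) by (simp add: infdist_nonneg)
    qed
  qed
  moreover have "(cnj s, s) \<noteq> 0" using s1 by (auto simp: zero_prod_def)
  ultimately have tanT: "tangent_line deltoid (sphere 0 1) t T"
    unfolding tangent_line_def using line by blast
  have "t islimpt sphere 0 1"
  proof (rule connected_imp_perfect)
    show "connected (sphere (0::complex) 1)" by (intro connected_sphere) simp
    fix a :: complex
    have "1 \<in> sphere (0::complex) 1" "-1 \<in> sphere (0::complex) 1" by auto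
    then show "sphere 0 1 \<noteq> {a}" by (metis one_neq_neg_one singletonD)
  qed (rule t)
  then have nontriv: "at t within sphere 0 1 \<noteq> bot" by (simp add: trivial_limit_within)
  have "eventually (\<lambda>u. deltoid u \<noteq> deltoid t) (at t within sphere 0 1)"
    using onS C(2)
  proof eventually_elim
    case (elim u)
    then have "dist (deltoid u) (deltoid t) > 0" using dd by simp
    then show ?case by simp
  qed
  then show ?thesis
    using tangent_line_unique[OF _ tanT nontriv] tanT unfolding T_def[symmetric] by blast
qed

end

theory Submission
  imports Defs "HOL-Computational_Algebra.Fundamental_Theorem_Algebra"
begin

text \<open>If \<open>u, v, w\<close> are the roots of \<open>T\<^sup>3 - x T\<^sup>2 + y T - 1\<close>, then the second iterate of the deltoid map sends
  \<open>(x, y)\<close> to the point with roots \<open>u\<^sup>4, v\<^sup>4, w\<^sup>4\<close>. Since \<open>u v w = 1\<close>, if no root is unimodular then the even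
  iterates tend to \<open>[1:0:0]\<close> or \<open>[0:1:0]\<close>, according to whether one or two roots lie outside the unit disc,
  and these two points form an attracting cycle. If some root is unimodular, arbitrarily small perturbations
  of the roots lead to either limit, so equicontinuity fails. Hence the affine part of the Julia set
  consists of the \<open>(x, y)\<close> whose cubic has a unimodular root \<open>t\<close>. On a line \<open>y = b\<close> this gives
  \<open>x = t + b / t - 1 / t\<^sup>2\<close>, and \<open>(x + cnj b) / 2\<close> is the foot of the perpendicular from \<open>cnj b\<close> to the tangent
  of the deltoid at \<open>t\<close>.\<close>

section \<open>Fatou sets of continuous maps\<close>

lemma continuous_on_funpow:
  fixes f :: "'a::topological_space \<Rightarrow> 'a"
  assumes "continuous_on UNIV f"
  shows "continuous_on UNIV (f ^^ n)"
proof (induction n)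
  case (Suc n)
  then show ?case
    using continuous_on_compose[OF Suc continuous_on_subset[OF assms subset_UNIV]] by simp
qed (simp add: id_def)

lemma in_fatou_setI:
  assumes "open V" "x \<in> V" "equicontinuous_on V (range (\<lambda>n. f ^^ n))"
  shows "x \<in> fatou_set f"
proof -
  have "locally_equicontinuous_on V (range (\<lambda>n. f ^^ n))"
    unfolding locally_equicontinuous_on_def using assms by blast
  then show ?thesis using assms unfolding fatou_set_def by blast
qed

lemma in_fatou_setE:
  assumes "x \<in> fatou_set f"
  obtains V where "open V" "x \<in> V" "equicontinuous_on V (range (\<lambda>n. f ^^ n))"
  using fatou_set_is_largest(2)[of f] assms unfolding locally_equicontinuous_on_def by blast

text \<open>Iterate \<open>n + 1\<close> factors as iterate \<open>n\<close> after \<open>f\<close>,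
  so continuity of \<open>f\<close> transports a modulus of equicontinuity on \<open>V\<close> back
  to its preimage.\<close>

lemma fatou_set_preimage:
  fixes f :: "'a::metric_space \<Rightarrow> 'a"
  assumes f: "continuous_on UNIV f" and x: "f x \<in> fatou_set f"
  shows "x \<in> fatou_set f"
proof -
  obtain V where V: "open V" "f x \<in> V" "equicontinuous_on V (range (\<lambda>n. f ^^ n))"
    using x by (rule in_fatou_setE)
  have "equicontinuous_on (f -` V) (range (\<lambda>n. f ^^ n))"
    unfolding equicontinuous_on_def
  proof (intro ballI allI impI)
    fix a and e :: real
    assume a: "a \<in> f -` V" and e: "e > 0"
    obtain d where d: "d > 0" "\<And>n b. b \<in> V \<Longrightarrow> dist b (f a) < d \<Longrightarrow> dist ((f ^^ n) b) ((f ^^ n) (f a)) < e"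
      using V(3) a e unfolding equicontinuous_on_def by (metis rangeI vimageE)
    obtain d' where d': "d' > 0" "\<And>b. dist b a < d' \<Longrightarrow> dist (f b) (f a) < d"
      using f d(1) unfolding continuous_on_iff by (metis UNIV_I)
    \<comment> \<open>Iterate \<open>0\<close> does not factor through \<open>f\<close>; the
      \<open>e\<close> in the minimum takes care of it.\<close>
    have "dist ((f ^^ n) b) ((f ^^ n) a) < e" if "b \<in> f -` V" "dist b a < min d' e" for n b
    proof (cases n)
      case (Suc m)
      then show ?thesis using d(2)[of "f b" m] d'(2)[of b] that by (simp add: funpow_swap1)
    qed (use that in simp)
    then show "\<exists>d>0. \<forall>g\<in>range (\<lambda>n. f ^^ n). \<forall>y\<in>f -` V. dist y a < d \<longrightarrow> dist (g y) (g a) < e"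
      using d'(1) e by (intro exI[of _ "min d' e"]) auto
  qed
  moreover have "open (f -` V)" using V(1) f by (simp add: open_vimage)
  ultimately show ?thesis using V(2) in_fatou_setI[of "f -` V"] by simp
qed

lemma fatou_set_funpow_preimage:
  fixes f :: "'a::metric_space \<Rightarrow> 'a"
  assumes "continuous_on UNIV f" "(f ^^ n) x \<in> fatou_set f"
  shows "x \<in> fatou_set f"
  using assms(2) by (induction n) (auto intro: fatou_set_preimage[OF assms(1)])

text \<open>Late iterates of all of \<open>W\<close> stay within \<open>e / 2\<close> of the orbit
  of \<open>p\<close>, and the finitely many earlier ones are continuous. Comparing with the orbit
  of \<open>p\<close> instead of with a fixed limit makes this applicable to a cycle.\<close>

lemma uniform_attraction_imp_fatou:
  fixes f :: "'a::metric_space \<Rightarrow> 'a"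
  assumes f: "continuous_on UNIV f" and W: "open W"
    and p: "p \<in> W"
    and conv: "\<And>e. e > 0 \<Longrightarrow> \<exists>N. \<forall>n\<ge>N. \<forall>q\<in>W. dist ((f ^^ n) q) ((f ^^ n) p) < e"
  shows "p \<in> fatou_set f"
proof -
  have "equicontinuous_on W (range (\<lambda>n. f ^^ n))"
    unfolding equicontinuous_on_def
  proof (intro ballI allI impI)
    fix a and e :: real
    assume a: "a \<in> W" and e: "e > 0"
    obtain N where N: "\<And>n q. n \<ge> N \<Longrightarrow> q \<in> W \<Longrightarrow> dist ((f ^^ n) q) ((f ^^ n) p) < e / 2"
      using conv[of "e / 2"] e by auto
    have "isCont (f ^^ n) a" for n
      using continuous_on_funpow[OF f] by (simp add: continuous_on_eq_continuous_at)
    then have "eventually (\<lambda>b. dist ((f ^^ n) b) ((f ^^ n) a) < e) (nhds a)" for n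
      using e by (auto simp: isCont_def tendsto_iff eventually_nhds_conv_at)
    then have "eventually (\<lambda>b. \<forall>n\<in>{..<N}. dist ((f ^^ n) b) ((f ^^ n) a) < e) (nhds a)"
      by (intro eventually_ball_finite) auto
    then obtain d where d: "d > 0" "\<And>b n. dist b a < d \<Longrightarrow> n < N \<Longrightarrow> dist ((f ^^ n) b) ((f ^^ n) a) < e"
      unfolding eventually_nhds_metric by blast
    have "dist ((f ^^ n) b) ((f ^^ n) a) < e" if "b \<in> W" "dist b a < d" for n b
    proof (cases "n < N")
      case False
      then show ?thesis
        using dist_triangle_half_l[OF N[of n b] N[of n a]] that a by simp
    qed (use that d in simp)
    then show "\<exists>d>0. \<forall>g\<in>range (\<lambda>n. f ^^ n). \<forall>y\<in>W. dist y a < d \<longrightarrow> dist (g y) (g a) < e"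
      using d(1) by (intro exI[of _ d]) auto
  qed
  then show ?thesis using W p in_fatou_setI by blast
qed

text \<open>Equicontinuity at \<open>p\<close> would keep the orbits of all nearby points close to
  that of \<open>p\<close>, yet some of them separate towards \<open>a\<close> and \<open>b\<close>.
  The subsequence \<open>r\<close> allows limits along even iterates only.\<close>

lemma distinct_limits_imp_julia:
  fixes f :: "'a::metric_space \<Rightarrow> 'a"
  assumes r: "filterlim r sequentially sequentially" and "a \<noteq> b"
    and near: "\<And>U. open U \<Longrightarrow> p \<in> U \<Longrightarrow>
      \<exists>q\<in>U. \<exists>q'\<in>U. (\<lambda>n. (f ^^ r n) q) \<longlonglongrightarrow> a \<and> (\<lambda>n. (f ^^ r n) q') \<longlonglongrightarrow> b"
  shows "p \<in> julia_set f"
proof (rule ccontr)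
  assume "p \<notin> julia_set f"
  then obtain V where V: "open V" "p \<in> V" "equicontinuous_on V (range (\<lambda>n. f ^^ n))"
    unfolding julia_set_def by (auto elim: in_fatou_setE)
  \<comment> \<open>The path from \<open>a\<close> to \<open>b\<close> through the iterates of
    \<open>q\<close>, \<open>p\<close> and \<open>q'\<close> has four legs, each shorter than
    \<open>e\<close>.\<close>
  define e where "e = dist a b / 4"
  have e: "e > 0" using \<open>a \<noteq> b\<close> by (simp add: e_def)
  then obtain d where d: "d > 0" "\<And>n q. q \<in> V \<Longrightarrow> dist q p < d \<Longrightarrow> dist ((f ^^ n) q) ((f ^^ n) p) < e"
    using V(2,3) unfolding equicontinuous_on_def by (metis rangeI)
  have "open (V \<inter> ball p d)" "p \<in> V \<inter> ball p d" using V d by auto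
  from near[OF this] obtain q q' where q: "q \<in> V" "q' \<in> V" "dist q p < d" "dist q' p < d"
    "(\<lambda>n. (f ^^ r n) q) \<longlonglongrightarrow> a" "(\<lambda>n. (f ^^ r n) q') \<longlonglongrightarrow> b"
    by (auto simp: dist_commute)
  have "eventually (\<lambda>n. dist ((f ^^ r n) q) a < e \<and> dist ((f ^^ r n) q') b < e) sequentially"
    using q(5,6) e by (auto simp: tendsto_iff eventually_conj_iff)
  then obtain n where n: "dist ((f ^^ r n) q) a < e" "dist ((f ^^ r n) q') b < e"
    by (auto simp: eventually_sequentially)
  have "dist a b < 4 * e"
    using n d(2)[OF q(1,3), of "r n"] d(2)[OF q(2,4), of "r n"] by metric
  then show False by (simp add: e_def)
qed


section \<open>The deltoid map\<close>

lemma vector_3_eq_0_iff [simp]: "vector [x, y, z] = (0 :: complex^3) \<longleftrightarrow> x = 0 \<and> y = 0 \<and> z = 0"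
  by (auto simp: vec_eq_iff forall_3)

lemma vector_3_components: "(vector [v $ 1, v $ 2, v $ 3] :: 'a::zero^3) = v"
  by (simp add: vec_eq_iff forall_3)

lemma proj_point_cases:
  obtains x y z where "(x, y, z) \<noteq> (0, 0, 0)" "p = proj_point x y z"
proof -
  obtain v where v: "v \<noteq> 0" "p = abs_cp2 v" by (rule cp2_cases)
  then have "p = proj_point (v $ 1) (v $ 2) (v $ 3)"
    by (simp add: proj_point_def vector_3_components)
  moreover have "(v $ 1, v $ 2, v $ 3) \<noteq> (0, 0, 0)" using v(1) by (auto simp: vec_eq_iff forall_3)
  ultimately show thesis using that by blast
qed

lemma proj_point_eq_iff:
  assumes "(x, y, z) \<noteq> (0, 0, 0)" "(x', y', z') \<noteq> (0, 0, 0)"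
  shows "proj_point x y z = proj_point x' y' z' \<longleftrightarrow> (\<exists>c. x' = c * x \<and> y' = c * y \<and> z' = c * z)"
  unfolding proj_point_def using assms
  by (subst abs_cp2_eq_iff) (auto simp: vec_eq_iff forall_3)

lemma proj_point_divide:
  assumes "c \<noteq> 0" "(x, y, z) \<noteq> (0, 0, 0)"
  shows "proj_point (x / c) (y / c) (z / c) = proj_point x y z"
  using assms by (subst proj_point_eq_iff) (auto intro: exI[of _ c])

section \<open>Continuity through homogeneous coordinates\<close>

lemma continuous_on_abs_cp2: "continuous_on (-{0}) abs_cp2"
proof -
  have "abs_cp2 -` U \<inter> -{0} = {v. v \<noteq> 0 \<and> abs_cp2 v \<in> U}" for U by auto
  then show ?thesis
    using open_cp2_iff by (subst continuous_on_open_vimage) auto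
qed

lemma tendsto_proj_point:
  assumes "(f \<longlongrightarrow> x) F" "(g \<longlongrightarrow> y) F" "(h \<longlongrightarrow> z) F" and "(x, y, z) \<noteq> (0, 0, 0)"
  shows "((\<lambda>n. proj_point (f n) (g n) (h n)) \<longlongrightarrow> proj_point x y z) F"
proof -
  have "((\<lambda>n. vector [f n, g n, h n] :: complex^3) \<longlongrightarrow> vector [x, y, z]) F"
  proof (rule vec_tendstoI)
    show "((\<lambda>n. (vector [f n, g n, h n] :: complex^3) $ i) \<longlongrightarrow> vector [x, y, z] $ i) F" for i
      using assms(1-3) exhaust_3[of i] by auto
  qed
  moreover have "isCont abs_cp2 (vector [x, y, z])"
    using continuous_on_abs_cp2 assms(4) by (auto simp: continuous_on_eq_continuous_at open_Compl)
  ultimately show ?thesis unfolding proj_point_def by (rule isCont_tendsto_compose[rotated])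
qed

text \<open>The topology is the quotient topology, so it suffices that the polynomial lift
  \<open>F\<close> is continuous and has no zero other than the origin.\<close>

lemma continuous_on_deltoid_map: "continuous_on UNIV deltoid_map"
  unfolding continuous_on_open_vimage[OF open_UNIV]
proof (intro allI impI)
  fix U :: "cp2 set" assume U: "open U"
  define F :: "complex^3 \<Rightarrow> complex^3" where
    "F v = vector [(v $ 2)\<^sup>2 - 2 * v $ 1 * v $ 3, (v $ 1)\<^sup>2 - 2 * v $ 2 * v $ 3, (v $ 3)\<^sup>2]" for v
  have F: "deltoid_map (abs_cp2 v) = abs_cp2 (F v)" "F v \<noteq> 0" if "v \<noteq> 0" for v
    using that unfolding F_def
    by (subst deltoid_map.abs_eq) (use that in \<open>auto intro: exI[of _ 1] simp: vec_eq_iff forall_3\<close>)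
  have "continuous_on UNIV (\<lambda>v. F v $ i)" for i
    using exhaust_3[of i]
    by (elim disjE; simp add: F_def; intro continuous_intros continuous_on_component)
  then have "continuous_on UNIV F" using continuous_on_vec_lambda[of UNIV "\<lambda>i v. F v $ i"] by simp
  moreover have "open {w. w \<noteq> 0 \<and> abs_cp2 w \<in> U}" using U by (simp add: open_cp2_iff)
  ultimately have "open (-{0} \<inter> F -` {w. w \<noteq> 0 \<and> abs_cp2 w \<in> U})"
    by (intro open_Int open_vimage) auto
  moreover have "-{0} \<inter> F -` {w. w \<noteq> 0 \<and> abs_cp2 w \<in> U} = {v. v \<noteq> 0 \<and> abs_cp2 v \<in> deltoid_map -` U}"
  proof (rule set_eqI)
    show "v \<in> -{0} \<inter> F -` {w. w \<noteq> 0 \<and> abs_cp2 w \<in> U} \<longleftrightarrow> v \<in> {v. v \<noteq> 0 \<and> abs_cp2 v \<in> deltoid_map -` U}" for v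
      by (cases "v = 0") (simp_all add: F)
  qed
  ultimately show "open (deltoid_map -` U \<inter> UNIV)" by (simp add: open_cp2_iff)
qed


section \<open>The attracting cycle at infinity\<close>

text \<open>In the charts around \<open>[1:0:0]\<close> and \<open>[0:1:0]\<close> the map is \<open>(y, z) \<mapsto> (y\<^sup>2 - 2 z, z\<^sup>2) / (1 - 2 y z)\<close>. Its derivative
  at the origin is \<open>(y, z) \<mapsto> (- 2 z, 0)\<close>, which expands the maximum norm; weighting \<open>z\<close> by \<open>4\<close> makes every single
  step a contraction.\<close>

lemma deltoid_contraction:
  fixes y z :: complex
  assumes y: "cmod y \<le> r" and z: "4 * cmod z \<le> r" and r: "r \<le> 1 / 8"
  defines "D \<equiv> 1 - 2 * y * z"
  shows "D \<noteq> 0" "cmod ((y\<^sup>2 - 2 * z) / D) \<le> 3 / 4 * r" "4 * cmod (z\<^sup>2 / D) \<le> 3 / 4 * r"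
proof -
  have r0: "r \<ge> 0" using y norm_ge_zero order_trans by blast
  \<comment> \<open>This turns the quadratic terms into linear ones.\<close>
  have rr: "r * r \<le> 1 / 8 * r" using r r0 by (intro mult_right_mono) auto
  have "cmod (2 * y * z) \<le> 1 / 16"
    using mult_mono[OF y z r0] rr r by (simp add: norm_mult)
  then have D: "cmod D \<ge> 15 / 16"
    using norm_triangle_ineq2[of 1 "2 * y * z"] by (simp add: D_def)
  then show "D \<noteq> 0" by auto
  \<comment> \<open>The constant is \<open>45 / 64 = 3 / 4 * (15 / 16)\<close>: dividing by
    \<open>D\<close> costs at most a factor \<open>16 / 15\<close>.\<close>
  have quot: "cmod (a / D) \<le> 3 / 4 * s" if "cmod a \<le> 45 / 64 * s" for a s
  proof -
    have "s \<ge> 0" using that norm_ge_zero[of a] by linarith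
    then have "45 / 64 * s \<le> 3 / 4 * s * cmod D"
      using mult_left_mono[OF D, of "3 / 4 * s"] by simp
    then show ?thesis using that \<open>D \<noteq> 0\<close> by (simp add: norm_divide pos_divide_le_eq)
  qed
  have "cmod (y\<^sup>2 - 2 * z) \<le> cmod y * cmod y + 2 * cmod z"
    using norm_triangle_ineq4[of "y\<^sup>2" "2 * z"] by (simp add: norm_mult power2_eq_square)
  also have "\<dots> \<le> r * r + r / 2" using mult_mono[OF y y r0] z by simp
  finally have "cmod (y\<^sup>2 - 2 * z) \<le> 45 / 64 * r" using rr r0 by linarith
  then show "cmod ((y\<^sup>2 - 2 * z) / D) \<le> 3 / 4 * r" by (rule quot)
  have "4 * cmod z * (4 * cmod z) \<le> r * r" using z r0 by (intro mult_mono) auto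
  then have "cmod (z\<^sup>2) \<le> 45 / 64 * (r / 4)"
    using rr r0 by (simp add: norm_mult power2_eq_square)
  from quot[OF this] show "4 * cmod (z\<^sup>2 / D) \<le> 3 / 4 * r" by simp
qed

text \<open>The map commutes with exchanging the first two coordinates; hence it interchanges the
  two charts and has the same expression in both.\<close>

lemma deltoid_map_near_cycle:
  fixes y z :: complex
  defines "D \<equiv> 1 - 2 * y * z"
  assumes D: "D \<noteq> 0"
  shows "deltoid_map (proj_point 1 y z) = proj_point ((y\<^sup>2 - 2 * z) / D) 1 (z\<^sup>2 / D)"
    and "deltoid_map (proj_point y 1 z) = proj_point 1 ((y\<^sup>2 - 2 * z) / D) (z\<^sup>2 / D)"
  using proj_point_divide[of D "y\<^sup>2 - 2 * z" D "z\<^sup>2"] proj_point_divide[of D D "y\<^sup>2 - 2 * z" "z\<^sup>2"] D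
  by (simp_all add: deltoid_map_proj_point D_def mult.commute)

lemma funpow_deltoid_near_cycle:
  fixes y z :: complex
  assumes "cmod y \<le> 1 / 8" "4 * cmod z \<le> 1 / 8"
  shows "\<exists>y' z'. cmod y' \<le> (3 / 4) ^ n / 8 \<and> 4 * cmod z' \<le> (3 / 4) ^ n / 8 \<and>
      (deltoid_map ^^ n) (proj_point 1 y z) = (if even n then proj_point 1 y' z' else proj_point y' 1 z')"
proof (induction n)
  case 0
  then show ?case using assms by auto
next
  case (Suc n)
  then obtain y' z' where IH: "cmod y' \<le> (3 / 4) ^ n / 8" "4 * cmod z' \<le> (3 / 4) ^ n / 8"
    "(deltoid_map ^^ n) (proj_point 1 y z) = (if even n then proj_point 1 y' z' else proj_point y' 1 z')"
    by blast
  have "(3 / 4 :: real) ^ n / 8 \<le> 1 / 8" by (simp add: power_le_one)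
  note c = deltoid_contraction[OF IH(1,2) this]
  show ?case
    using c(2,3) deltoid_map_near_cycle[OF c(1)] IH(3)
    by (intro exI[of _ "(y'\<^sup>2 - 2 * z') / (1 - 2 * y' * z')"] exI[of _ "z'\<^sup>2 / (1 - 2 * y' * z')"]) simp
qed

text \<open>Clearing denominators turns the bounds into strict inequalities between continuous
  functions of \<open>v\<close>, and these force \<open>v $ 1\<close> to be nonzero.\<close>

lemma open_polydisc_around_1_0_0:
  "open {proj_point 1 y z | y z. cmod y < r \<and> cmod z < s}" (is "open ?W")
proof -
  have "v \<noteq> 0 \<and> abs_cp2 v \<in> ?W \<longleftrightarrow> cmod (v $ 2) < r * cmod (v $ 1) \<and> cmod (v $ 3) < s * cmod (v $ 1)" for v
  proof
    assume v: "v \<noteq> 0 \<and> abs_cp2 v \<in> ?W"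
    then obtain y z where yz: "abs_cp2 v = proj_point 1 y z" "cmod y < r" "cmod z < s" by blast
    then obtain c where "v = c *s vector [1, y, z]"
      using v abs_cp2_eq_iff[of "vector [1, y, z]" v] by (auto simp: proj_point_def)
    then have "v $ 1 = c" "v $ 2 = c * y" "v $ 3 = c * z" "c \<noteq> 0" using v by auto
    then show "cmod (v $ 2) < r * cmod (v $ 1) \<and> cmod (v $ 3) < s * cmod (v $ 1)"
      using yz by (simp add: norm_mult mult.commute)
  next
    assume v: "cmod (v $ 2) < r * cmod (v $ 1) \<and> cmod (v $ 3) < s * cmod (v $ 1)"
    then have v1: "v $ 1 \<noteq> 0" by auto
    have "abs_cp2 v = proj_point 1 (v $ 2 / v $ 1) (v $ 3 / v $ 1)"
      using proj_point_divide[OF v1, of "v $ 1" "v $ 2" "v $ 3"] v1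
      by (simp add: proj_point_def vector_3_components)
    then show "v \<noteq> 0 \<and> abs_cp2 v \<in> ?W"
      using v v1 by (fastforce simp: norm_divide divide_simps)
  qed
  then show ?thesis
    unfolding open_cp2_iff by (simp only:) (intro open_Collect_conj open_Collect_less continuous_intros; simp)
qed

text \<open>A whole polydisc follows the orbit of \<open>[1:0:0]\<close> with geometrically
  decreasing error in alternating charts, and \<open>[0:1:0]\<close> is mapped to
  \<open>[1:0:0]\<close>.\<close>

lemma deltoid_cycle_in_fatou:
  shows "proj_point 1 0 0 \<in> fatou_set deltoid_map" and "proj_point 0 1 0 \<in> fatou_set deltoid_map"
proof -
  let ?W = "{proj_point 1 y z | y z. cmod y < 1 / 8 \<and> cmod z < 1 / 32}"
  show *: "proj_point 1 0 0 \<in> fatou_set deltoid_map"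
  proof (rule uniform_attraction_imp_fatou[OF continuous_on_deltoid_map, where W = ?W])
    show "open ?W" by (rule open_polydisc_around_1_0_0)
    show "proj_point 1 0 0 \<in> ?W" by force
    fix e :: real assume e: "e > 0"
    \<comment> \<open>Continuity of both chart maps at the origin converts smallness of the chart
      coordinates into smallness of the distance in \<open>cp2\<close>.\<close>
    have "((\<lambda>v. fst v) \<longlongrightarrow> 0) (nhds (0 :: complex, 0 :: complex))" "((\<lambda>v. snd v) \<longlongrightarrow> 0) (nhds (0 :: complex, 0 :: complex))"
      using tendsto_fst[OF filterlim_ident, of "(0, 0)"] tendsto_snd[OF filterlim_ident, of "(0, 0)"] by simp_all
    then have "((\<lambda>v. proj_point 1 (fst v) (snd v)) \<longlongrightarrow> proj_point 1 0 0) (nhds (0, 0))"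
      "((\<lambda>v. proj_point (fst v) 1 (snd v)) \<longlongrightarrow> proj_point 0 1 0) (nhds (0, 0))"
      by (auto intro!: tendsto_proj_point)
    from this[THEN tendstoD, OF e]
    have "eventually (\<lambda>v. dist (proj_point 1 (fst v) (snd v)) (proj_point 1 0 0) < e \<and>
        dist (proj_point (fst v) 1 (snd v)) (proj_point 0 1 0) < e) (nhds (0, 0))"
      by (rule eventually_conj)
    then obtain d where d: "d > 0"
      "\<And>v. dist v (0, 0) < d \<Longrightarrow> dist (proj_point 1 (fst v) (snd v)) (proj_point 1 0 0) < e \<and>
        dist (proj_point (fst v) 1 (snd v)) (proj_point 0 1 0) < e"
      unfolding eventually_nhds_metric by blast
    obtain N where N: "(3 / 4) ^ N < d" using real_arch_pow_inv[OF d(1), of "3 / 4"] by auto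
    have "dist ((deltoid_map ^^ n) q) ((deltoid_map ^^ n) (proj_point 1 0 0)) < e" if n: "n \<ge> N" and q: "q \<in> ?W" for n q
    proof -
      obtain y z where yz: "q = proj_point 1 y z" "cmod y < 1 / 8" "cmod z < 1 / 32" using q by blast
      obtain y' z' where yz': "cmod y' \<le> (3 / 4) ^ n / 8" "4 * cmod z' \<le> (3 / 4) ^ n / 8"
        "(deltoid_map ^^ n) q = (if even n then proj_point 1 y' z' else proj_point y' 1 z')"
        using funpow_deltoid_near_cycle[of y z n] yz by auto
      have "(3 / 4 :: real) ^ n \<le> (3 / 4) ^ N" using n by (intro power_decreasing) auto
      moreover have "dist (y', z') (0, 0) \<le> cmod y' + cmod z'"
        using norm_Pair_le[of y' z'] by (simp add: dist_norm flip: zero_prod_def)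
      ultimately have "dist (y', z') (0, 0) < d"
        using yz'(1,2) N norm_ge_zero[of z'] by linarith
      moreover have "(deltoid_map ^^ n) (proj_point 1 0 0) = (if even n then proj_point 1 0 0 else proj_point 0 1 0)"
        by (induction n) (simp_all add: deltoid_map_proj_point)
      ultimately show ?thesis using d(2)[of "(y', z')"] yz'(3) by simp
    qed
    then show "\<exists>N. \<forall>n\<ge>N. \<forall>q\<in>?W.
        dist ((deltoid_map ^^ n) q) ((deltoid_map ^^ n) (proj_point 1 0 0)) < e" by blast
  qed
  have "deltoid_map (proj_point 0 1 0) = proj_point 1 0 0" by (simp add: deltoid_map_proj_point)
  then show "proj_point 0 1 0 \<in> fatou_set deltoid_map"
    using fatou_set_preimage[OF continuous_on_deltoid_map, of "proj_point 0 1 0"] * by simp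
qed


section \<open>The affine part of the Julia set\<close>

lemma funpow_deltoid_roots:
  assumes "u * v * w = (1 :: complex)"
  shows "(deltoid_map ^^ (2 * n)) (proj_point (u + v + w) (u * v + u * w + v * w) 1) =
    proj_point (u ^ 4 ^ n + v ^ 4 ^ n + w ^ 4 ^ n)
      ((u * v) ^ 4 ^ n + (u * w) ^ 4 ^ n + (v * w) ^ 4 ^ n) 1"
proof (induction n)
  case (Suc n)
  define a b c where abc: "a = u ^ 4 ^ n" "b = v ^ 4 ^ n" "c = w ^ 4 ^ n"
  have 1: "a * b * c = 1" using assms unfolding abc by (simp flip: power_mult_distrib)
  have pow4: "(z ^ 4 ^ n) ^ 4 = z ^ 4 ^ Suc n" for z :: complex
    by (simp only: power_Suc2 power_mult)
  \<comment> \<open>Because \<open>a * b * c = 1\<close>, one step squares the roots and exchanges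
    the two elementary symmetric functions; the second step squares again and restores their
    order.\<close>
  have sq: "(a * b + a * c + b * c)\<^sup>2 - 2 * (a + b + c) = (a * b)\<^sup>2 + (a * c)\<^sup>2 + (b * c)\<^sup>2"
    "(a + b + c)\<^sup>2 - 2 * (a * b + a * c + b * c) = a\<^sup>2 + b\<^sup>2 + c\<^sup>2"
    "(a\<^sup>2 + b\<^sup>2 + c\<^sup>2)\<^sup>2 - 2 * ((a * b)\<^sup>2 + (a * c)\<^sup>2 + (b * c)\<^sup>2) = a ^ 4 + b ^ 4 + c ^ 4"
    "((a * b)\<^sup>2 + (a * c)\<^sup>2 + (b * c)\<^sup>2)\<^sup>2 - 2 * (a\<^sup>2 + b\<^sup>2 + c\<^sup>2) = (a * b) ^ 4 + (a * c) ^ 4 + (b * c) ^ 4"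
    using 1 by algebra+
  have "(deltoid_map ^^ (2 * Suc n)) (proj_point (u + v + w) (u * v + u * w + v * w) 1) =
      deltoid_map (deltoid_map (proj_point (a + b + c) (a * b + a * c + b * c) 1))"
    using Suc by (simp add: abc power_mult_distrib)
  also have "\<dots> = proj_point (a ^ 4 + b ^ 4 + c ^ 4) ((a * b) ^ 4 + (a * c) ^ 4 + (b * c) ^ 4) 1"
    using sq by (simp add: deltoid_map_proj_point)
  also have "\<dots> = proj_point (u ^ 4 ^ Suc n + v ^ 4 ^ Suc n + w ^ 4 ^ Suc n)
      ((u * v) ^ 4 ^ Suc n + (u * w) ^ 4 ^ Suc n + (v * w) ^ 4 ^ Suc n) 1"
    unfolding abc by (simp only: pow4 flip: power_mult_distrib)
  finally show ?case .
qed simp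

lemma power_4_power_tendsto_zero:
  fixes z :: complex
  assumes "cmod z < 1"
  shows "(\<lambda>n. z ^ 4 ^ n) \<longlonglongrightarrow> 0"
  using LIMSEQ_subseq_LIMSEQ[OF LIMSEQ_power_zero[OF assms], of "\<lambda>n. 4 ^ n"]
  by (simp add: strict_mono_def comp_def)

text \<open>The inverse of \<open>u\<close> is \<open>v * w\<close>, so dividing by a power of
  \<open>u\<close> multiplies by that power of \<open>v * w\<close>. Every term except the constant
  \<open>1\<close> becomes a power of a number in the open unit disc. The three quotients are the
  rescaled homogeneous coordinates of the even iterates.\<close>

lemma tendsto_dominant_root:
  assumes 1: "u * v * w = (1 :: complex)" and vw: "cmod v < 1" "cmod w < 1"
  shows "(\<lambda>n. (u ^ 4 ^ n + v ^ 4 ^ n + w ^ 4 ^ n) / u ^ 4 ^ n) \<longlonglongrightarrow> 1"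
    and "(\<lambda>n. ((u * v) ^ 4 ^ n + (u * w) ^ 4 ^ n + (v * w) ^ 4 ^ n) / u ^ 4 ^ n) \<longlonglongrightarrow> 0"
    and "(\<lambda>n. 1 / u ^ 4 ^ n) \<longlonglongrightarrow> 0"
proof -
  have nz: "u \<noteq> 0" using 1 by auto
  have inv: "inverse u = v * w" by (rule inverse_unique) (use 1 in \<open>simp add: mult.assoc\<close>)
  have prod: "cmod (a * b) < 1" if "cmod a < 1" "cmod b < 1" for a b
    using mult_strict_mono'[OF that norm_ge_zero norm_ge_zero] by (simp add: norm_mult)
  note small = vw prod[OF vw] prod[OF vw(1) prod[OF vw]] prod[OF vw(2) prod[OF vw]] prod[OF prod[OF vw] prod[OF vw]]
  note lims = small[THEN power_4_power_tendsto_zero]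
  have pow: "a ^ N / u ^ N = (a * (v * w)) ^ N" for a N
    using inv by (simp add: divide_inverse power_mult_distrib flip: power_inverse)
  have "(\<lambda>n. 1 + (v * (v * w)) ^ 4 ^ n + (w * (v * w)) ^ 4 ^ n) \<longlonglongrightarrow> 1 + 0 + 0"
    by (intro tendsto_intros lims)
  then show "(\<lambda>n. (u ^ 4 ^ n + v ^ 4 ^ n + w ^ 4 ^ n) / u ^ 4 ^ n) \<longlonglongrightarrow> 1"
    using nz by (simp add: add_divide_distrib pow[of v] pow[of w])
  have "u * v * (v * w) = v" "u * w * (v * w) = w" using 1 by algebra+
  then have "((u * v) ^ 4 ^ n + (u * w) ^ 4 ^ n + (v * w) ^ 4 ^ n) / u ^ 4 ^ n =
      v ^ 4 ^ n + w ^ 4 ^ n + (v * w * (v * w)) ^ 4 ^ n" for n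
    by (simp only: add_divide_distrib pow)
  moreover have "(\<lambda>n. v ^ 4 ^ n + w ^ 4 ^ n + (v * w * (v * w)) ^ 4 ^ n) \<longlonglongrightarrow> 0 + 0 + 0"
    by (intro tendsto_intros lims)
  ultimately show "(\<lambda>n. ((u * v) ^ 4 ^ n + (u * w) ^ 4 ^ n + (v * w) ^ 4 ^ n) / u ^ 4 ^ n) \<longlonglongrightarrow> 0"
    by simp
  show "(\<lambda>n. 1 / u ^ 4 ^ n) \<longlonglongrightarrow> 0"
    using lims(3) pow[of 1] by simp
qed

lemma deltoid_tendsto_1_0_0:
  assumes 1: "u * v * w = (1 :: complex)" and vw: "cmod v < 1" "cmod w < 1"
  shows "(\<lambda>n. (deltoid_map ^^ (2 * n)) (proj_point (u + v + w) (u * v + u * w + v * w) 1)) \<longlonglongrightarrow> proj_point 1 0 0"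
proof -
  have nz: "u ^ 4 ^ n \<noteq> 0" for n using 1 by auto
  show ?thesis
    using tendsto_proj_point[OF tendsto_dominant_root[OF assms]] nz
    unfolding funpow_deltoid_roots[OF 1] by (simp add: proj_point_divide)
qed

text \<open>The numbers \<open>u v, u w, v w\<close> are the inverses of the roots, for which the roles of \<open>x\<close> and \<open>y\<close> are exchanged.\<close>

lemma deltoid_tendsto_0_1_0:
  assumes 1: "u * v * w = (1 :: complex)" and uv: "cmod u > 1" "cmod v > 1"
  shows "(\<lambda>n. (deltoid_map ^^ (2 * n)) (proj_point (u + v + w) (u * v + u * w + v * w) 1)) \<longlonglongrightarrow> proj_point 0 1 0"
proof -
  have prod: "u * v * (u * w) = u" "u * v * (v * w) = v" "u * w * (v * w) = w" "u * v * (u * w) * (v * w) = 1"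
    using 1 by algebra+
  have nz: "(u * v) ^ 4 ^ n \<noteq> 0" for n using 1 by auto
  have "cmod u * cmod (v * w) = 1" "cmod v * cmod (u * w) = 1"
    using 1 by (simp_all add: mult_ac flip: norm_mult)
  then have "cmod (u * w) < 1" "cmod (v * w) < 1"
    using uv by (smt (verit) mult_less_cancel_right1 norm_ge_zero)+
  \<comment> \<open>The dominant inverse root is \<open>u * v\<close>. The first two limits are used
    in exchanged order, since the pairwise products of the inverse roots are the roots
    themselves.\<close>
  note lims = tendsto_dominant_root[OF prod(4) this, unfolded prod]
  show ?thesis
    using tendsto_proj_point[OF lims(2,1,3)] nz
    unfolding funpow_deltoid_roots[OF 1] by (simp add: proj_point_divide)
qed

text \<open>The Fatou set is open, so the orbit enters it after finitely many steps, and membership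
  is pulled back along the iterate.\<close>

lemma tendsto_fatou_cycle_imp_fatou:
  assumes "(\<lambda>n. (deltoid_map ^^ (2 * n)) p) \<longlonglongrightarrow> q" "q \<in> fatou_set deltoid_map"
  shows "p \<in> fatou_set deltoid_map"
proof -
  have "eventually (\<lambda>n. (deltoid_map ^^ (2 * n)) p \<in> fatou_set deltoid_map) sequentially"
    using topological_tendstoD[OF assms(1) fatou_set_is_largest(1) assms(2)] .
  then obtain n where "(deltoid_map ^^ (2 * n)) p \<in> fatou_set deltoid_map"
    by (auto simp: eventually_sequentially)
  then show ?thesis by (rule fatou_set_funpow_preimage[OF continuous_on_deltoid_map])
qed

section \<open>Factoring the cubic\<close>

lemma cubic_remaining_roots:
  fixes x y t :: complex
  assumes "t ^ 3 - x * t\<^sup>2 + y * t - 1 = 0"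
  obtains v w where "t * v * w = 1" "x = t + v + w" "y = t * v + t * w + v * w"
proof -
  \<comment> \<open>Dividing out \<open>t\<close> leaves a quadratic with root sum
    \<open>x - t\<close> and root product \<open>1 / t\<close>; \<open>r\<close> is a square root of
    its discriminant.\<close>
  define r where "r = csqrt ((x - t)\<^sup>2 - 4 / t)"
  have t: "t \<noteq> 0" using assms by auto
  have r: "t * r\<^sup>2 = t * (x - t)\<^sup>2 - 4" using t by (simp add: r_def algebra_simps)
  define v w where "v = (x - t + r) / 2" and "w = (x - t - r) / 2"
  have vw: "2 * v = x - t + r" "2 * w = x - t - r" by (simp_all add: v_def w_def)
  have "4 * (t * v * w) = 4" using vw r by algebra
  then have 1: "t * v * w = 1" by simp
  have x: "x = t + v + w" by (simp add: v_def w_def field_simps)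
  have "t * y = t * (t * v + t * w + v * w)" using assms 1 x by algebra
  then have "y = t * v + t * w + v * w" using t by simp
  with 1 x show thesis by (rule that)
qed

lemma cubic_has_root: "\<exists>t::complex. t ^ 3 - x * t\<^sup>2 + y * t - 1 = 0"
proof -
  let ?p = "[:-1, y, -x, 1:]"
  have "\<not> constant (poly ?p)" by (simp add: constant_degree)
  then obtain t where "poly ?p t = 0" using fundamental_theorem_of_algebra by blast
  then show ?thesis by (intro exI[of _ t]) (simp add: algebra_simps power2_eq_square power3_eq_cube)
qed

text \<open>The product relation gives \<open>cmod w \<le> 1\<close>. Pushing \<open>u\<close>
  outwards and \<open>w\<close> inwards is therefore always possible, and the unimodular root
  \<open>t\<close> may be pushed to either side to select the limit.\<close>

lemma proj_point_in_julia:
  assumes 1: "u * t * w = (1 :: complex)" and ut: "cmod u \<ge> 1" "cmod t = 1"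
  shows "proj_point (u + t + w) (u * t + u * w + t * w) 1 \<in> julia_set deltoid_map"
proof (rule distinct_limits_imp_julia)
  show "filterlim (\<lambda>n::nat. 2 * n) sequentially sequentially"
    by (rule filterlim_subseq) (simp add: strict_mono_def)
  show "proj_point 1 0 0 \<noteq> proj_point 0 1 0" by (simp add: proj_point_eq_iff)
  have w: "cmod w \<le> 1"
  proof -
    have "cmod u * cmod w = 1" using 1 ut(2) by (metis norm_mult norm_one mult.right_neutral)
    then show ?thesis using mult_right_mono[OF ut(1), of "cmod w"] by simp
  qed
  fix U assume U: "open U" "proj_point (u + t + w) (u * t + u * w + t * w) 1 \<in> U"
  define P where "P a b c = proj_point (a + b + c) (a * b + a * c + b * c) 1" for a b c :: complex
  let ?z = "\<lambda>r. complex_of_real r"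
  \<comment> \<open>Both perturbations keep the product of the roots equal to \<open>1\<close>. For
    \<open>r > 1\<close> the first leaves two roots inside the unit disc, the second puts two
    outside.\<close>
  have "((\<lambda>r. P (u * (?z r)\<^sup>2) (t / ?z r) (w / ?z r)) \<longlongrightarrow> P u t w) (at_right 1)"
    "((\<lambda>r. P (u * ?z r) (t * ?z r) (w / (?z r)\<^sup>2)) \<longlongrightarrow> P u t w) (at_right 1)"
    unfolding P_def by (intro tendsto_proj_point; (auto intro!: tendsto_eq_intros)?)+
  from this[THEN topological_tendstoD, OF U(1)]
  have "eventually (\<lambda>r. (P (u * (?z r)\<^sup>2) (t / ?z r) (w / ?z r) \<in> U \<and>
      P (u * ?z r) (t * ?z r) (w / (?z r)\<^sup>2) \<in> U) \<and> r \<in> {1<..}) (at_right 1)"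
    using U(2) by (intro eventually_conj) (auto simp: P_def eventually_at_filter)
  then obtain r where r: "P (u * (?z r)\<^sup>2) (t / ?z r) (w / ?z r) \<in> U"
    "P (u * ?z r) (t * ?z r) (w / (?z r)\<^sup>2) \<in> U" "r > 1"
    using eventually_happens[of _ "at_right (1::real)"] by (auto simp: trivial_limit_at_right_real)
  have z0: "?z r \<noteq> 0" using r(3) by auto
  have "u * (?z r)\<^sup>2 * (t / ?z r) * (w / ?z r) = u * t * w" "u * ?z r * (t * ?z r) * (w / (?z r)\<^sup>2) = u * t * w"
    using z0 by (simp_all add: power2_eq_square)
  note prod = this[unfolded 1]
  have "(\<lambda>n. (deltoid_map ^^ (2 * n)) (P (u * (?z r)\<^sup>2) (t / ?z r) (w / ?z r))) \<longlonglongrightarrow> proj_point 1 0 0"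
    unfolding P_def using ut w r(3) by (intro deltoid_tendsto_1_0_0 prod) (auto simp: norm_divide)
  moreover have "(\<lambda>n. (deltoid_map ^^ (2 * n)) (P (u * ?z r) (t * ?z r) (w / (?z r)\<^sup>2))) \<longlonglongrightarrow> proj_point 0 1 0"
  proof -
    have "1 < cmod u * r" using mult_right_mono[OF ut(1), of r] r(3) by linarith
    then show ?thesis
      unfolding P_def using ut r(3) by (intro deltoid_tendsto_0_1_0 prod) (auto simp: norm_mult)
  qed
  ultimately show "\<exists>q\<in>U. \<exists>q'\<in>U. (\<lambda>n. (deltoid_map ^^ (2 * n)) q) \<longlonglongrightarrow> proj_point 1 0 0 \<and>
      (\<lambda>n. (deltoid_map ^^ (2 * n)) q') \<longlonglongrightarrow> proj_point 0 1 0"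
    using r(1,2) by blast
qed

lemma affine_julia_iff:
  "proj_point x y 1 \<in> julia_set deltoid_map \<longleftrightarrow> (\<exists>t\<in>sphere 0 1. t ^ 3 - x * t\<^sup>2 + y * t - 1 = 0)"
proof
  assume "\<exists>t\<in>sphere 0 1. t ^ 3 - x * t\<^sup>2 + y * t - 1 = 0"
  then obtain t where t: "cmod t = 1" "t ^ 3 - x * t\<^sup>2 + y * t - 1 = 0" by auto
  obtain v w where vw: "t * v * w = 1" "x = t + v + w" "y = t * v + t * w + v * w"
    using cubic_remaining_roots[OF t(2)] .
  have "cmod v * cmod w = 1" using vw(1) t(1) by (metis norm_mult norm_one mult_1)
  \<comment> \<open>Whichever of the two has modulus at least \<open>1\<close> plays the role of
    \<open>u\<close> in \<open>proj_point_in_julia\<close>.\<close>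
  then have "cmod v \<ge> 1 \<or> cmod w \<ge> 1"
    using mult_strict_mono'[of "cmod v" 1 "cmod w" 1] by fastforce
  then show "proj_point x y 1 \<in> julia_set deltoid_map"
    using proj_point_in_julia[of v t w] proj_point_in_julia[of w t v] t(1) vw by (auto simp: ac_simps)
next
  assume J: "proj_point x y 1 \<in> julia_set deltoid_map"
  show "\<exists>t\<in>sphere 0 1. t ^ 3 - x * t\<^sup>2 + y * t - 1 = 0"
  proof (rule ccontr)
    assume "\<not> ?thesis"
    then have no: "cmod t \<noteq> 1" if "t ^ 3 - x * t\<^sup>2 + y * t - 1 = 0" for t using that by auto
    obtain u where u: "u ^ 3 - x * u\<^sup>2 + y * u - 1 = 0" using cubic_has_root by blast
    obtain v w where vw: "u * v * w = 1" "x = u + v + w" "y = u * v + u * w + v * w"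
      using cubic_remaining_roots[OF u] .
    have "v ^ 3 - x * v\<^sup>2 + y * v - 1 = 0" "w ^ 3 - x * w\<^sup>2 + y * w - 1 = 0"
      using vw(1) unfolding vw(2,3) by algebra+
    note ne = no[OF u] this[THEN no]
    have perm: "u * v * w = 1" "v * u * w = 1" "w * u * v = 1" "u * w * v = 1" "v * w * u = 1"
      using vw(1) by (simp_all add: ac_simps)
    have lim: "(\<lambda>n. (deltoid_map ^^ (2 * n)) (proj_point x y 1)) \<longlonglongrightarrow> proj_point 1 0 0 \<or>
        (\<lambda>n. (deltoid_map ^^ (2 * n)) (proj_point x y 1)) \<longlonglongrightarrow> proj_point 0 1 0"
    proof -
      \<comment> \<open>With no root on the unit circle, two of the three lie on the same side of
        it.\<close>
      consider "cmod v < 1" "cmod w < 1" | "cmod u < 1" "cmod w < 1" | "cmod u < 1" "cmod v < 1"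
        | "cmod u > 1" "cmod v > 1" | "cmod u > 1" "cmod w > 1" | "cmod v > 1" "cmod w > 1"
        using ne by linarith
      then show ?thesis
      proof cases
        case 1 then show ?thesis using deltoid_tendsto_1_0_0[OF perm(1)] vw(2,3) by (simp add: ac_simps)
      next
        case 2 then show ?thesis using deltoid_tendsto_1_0_0[OF perm(2)] vw(2,3) by (simp add: ac_simps)
      next
        case 3 then show ?thesis using deltoid_tendsto_1_0_0[OF perm(3)] vw(2,3) by (simp add: ac_simps)
      next
        case 4 then show ?thesis using deltoid_tendsto_0_1_0[OF perm(1)] vw(2,3) by (simp add: ac_simps)
      next
        case 5 then show ?thesis using deltoid_tendsto_0_1_0[OF perm(4)] vw(2,3) by (simp add: ac_simps)
      next
        case 6 then show ?thesis using deltoid_tendsto_0_1_0[OF perm(5)] vw(2,3) by (simp add: ac_simps)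
      qed
    qed
    then have "proj_point x y 1 \<in> fatou_set deltoid_map"
      using tendsto_fatou_cycle_imp_fatou deltoid_cycle_in_fatou by blast
    then show False using J by (simp add: julia_set_def)
  qed
qed


section \<open>Pedal curves of the deltoid\<close>

lemma orthogonal_foot_unique:
  assumes "orthogonal_foot pt L P" "orthogonal_foot pt L Q"
  shows "P = Q"
proof -
  have "(pt - P) \<bullet> (Q - P) = 0" "(pt - Q) \<bullet> (P - Q) = 0"
    using assms by (auto simp: orthogonal_foot_def orthogonal_def)
  \<comment> \<open>Adding the two relations cancels \<open>pt\<close>.\<close>
  then have "(Q - P) \<bullet> (Q - P) = 0" by (simp add: inner_diff_left inner_diff_right inner_commute)
  then show ?thesis by simp
qed

text \<open>The tangent at \<open>t\<close> is the fixed line of the reflection sending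
  \<open>a\<close> to \<open>cnj t * cnj a + t - (cnj t)\<^sup>2\<close>, and \<open>p\<close> is
  the midpoint of \<open>a\<close> and its mirror image.\<close>

lemma orthogonal_foot_deltoid_tangent:
  fixes a t :: complex
  assumes t: "t \<in> sphere 0 1"
  defines "p \<equiv> (a + cnj t * cnj a + t - (cnj t)\<^sup>2) / 2"
  shows "orthogonal_foot (a, cnj a) {(x, cnj x) | x. t ^ 3 - t\<^sup>2 * x + t * cnj x - 1 = 0} (p, cnj p)"
  unfolding orthogonal_foot_def
proof (intro conjI ballI)
  have t1: "t * cnj t = 1" using t by (simp flip: complex_norm_square)
  have p2: "2 * p = a + cnj t * cnj a + t - (cnj t)\<^sup>2" "2 * cnj p = cnj a + t * a + cnj t - t\<^sup>2"
    by (simp_all add: p_def)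
  have "2 * (t ^ 3 - t\<^sup>2 * p + t * cnj p - 1) = 0" using p2 t1 by algebra
  then have p: "t ^ 3 - t\<^sup>2 * p + t * cnj p - 1 = 0" by (simp only: mult_eq_0_iff) simp
  then show "(p, cnj p) \<in> {(x, cnj x) | x. t ^ 3 - t\<^sup>2 * x + t * cnj x - 1 = 0}" by blast
  fix Q assume "Q \<in> {(x, cnj x) | x. t ^ 3 - t\<^sup>2 * x + t * cnj x - 1 = 0}"
  then obtain q where q: "Q = (q, cnj q)" "t ^ 3 - t\<^sup>2 * q + t * cnj q - 1 = 0" by blast
  \<comment> \<open>Conjugation multiplies directions along the line by \<open>t\<close> and normal
    directions by \<open>- t\<close>, so a normal times the conjugate of a direction is purely
    imaginary.\<close>
  have "cnj q - cnj p = t * (q - p)" using q(2) p t1 by algebra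
  moreover have "2 * (cnj a - cnj p) = 2 * (- t * (a - p))" using p2 t1 by algebra
  then have "cnj a - cnj p = - t * (a - p)" by (simp only: mult_cancel_left) simp
  ultimately have "(a - p) * cnj (q - p) + cnj (a - p) * (q - p) = 0"
    unfolding complex_cnj_diff by algebra
  then have "Re ((a - p) * cnj (q - p) + cnj (a - p) * (q - p)) = 0" by (simp only: zero_complex.sel)
  then have "Re ((a - p) * cnj (q - p)) = 0" by (simp add: algebra_simps)
  then show "orthogonal ((a, cnj a) - (p, cnj p)) (Q - (p, cnj p))"
    unfolding q(1) orthogonal_def by (simp add: inner_prod_def inner_complex_def algebra_simps)
qed

text \<open>Each parameter has exactly one tangent line, cusps included, and a line has at most one
  foot; so the pedal curve is parametrized by the circle.\<close>

lemma pedal_curve_deltoid: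
  "pedal_curve deltoid (sphere 0 1) (a, cnj a) =
    (\<lambda>t. let p = (a + cnj t * cnj a + t - (cnj t)\<^sup>2) / 2 in (p, cnj p)) ` sphere 0 1"
proof (intro set_eqI iffI)
  fix P assume "P \<in> pedal_curve deltoid (sphere 0 1) (a, cnj a)"
  then obtain t L where t: "t \<in> sphere 0 1" and L: "tangent_line deltoid (sphere 0 1) t L"
    and P: "orthogonal_foot (a, cnj a) L P"
    unfolding pedal_curve_def by blast
  note P = P[unfolded tangent_line_deltoid[OF t, THEN iffD1, OF L]]
  have "P = (let p = (a + cnj t * cnj a + t - (cnj t)\<^sup>2) / 2 in (p, cnj p))"
    unfolding Let_def by (rule orthogonal_foot_unique[OF P orthogonal_foot_deltoid_tangent[OF t]])
  then show "P \<in> (\<lambda>t. let p = (a + cnj t * cnj a + t - (cnj t)\<^sup>2) / 2 in (p, cnj p)) ` sphere 0 1"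
    using t by (rule image_eqI)
next
  fix P assume "P \<in> (\<lambda>t. let p = (a + cnj t * cnj a + t - (cnj t)\<^sup>2) / 2 in (p, cnj p)) ` sphere 0 1"
  then obtain t where t: "t \<in> sphere 0 1"
    "P = (let p = (a + cnj t * cnj a + t - (cnj t)\<^sup>2) / 2 in (p, cnj p))" by blast
  then show "P \<in> pedal_curve deltoid (sphere 0 1) (a, cnj a)"
    using orthogonal_foot_deltoid_tangent[OF t(1), of a] tangent_line_deltoid[OF t(1), THEN iffD2, OF refl]
    unfolding pedal_curve_def Let_def by blast
qed


section \<open>Lines through the points of the attracting cycle\<close>

lemma proj_point_in_proj_line_iff:
  assumes "(x, y, z) \<noteq> (0, 0, 0)"
  shows "proj_point x y z \<in> proj_line a b c \<longleftrightarrow> a * x + b * y + c * z = 0"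
proof
  assume "proj_point x y z \<in> proj_line a b c"
  then obtain x' y' z' where 1: "(x', y', z') \<noteq> (0, 0, 0)" "a * x' + b * y' + c * z' = 0"
    "proj_point x y z = proj_point x' y' z'" unfolding proj_line_def by blast
  then obtain k where "x = k * x'" "y = k * y'" "z = k * z'"
    using proj_point_eq_iff[OF 1(1) assms] 1(3) by auto
  then have "a * x + b * y + c * z = k * (a * x' + b * y' + c * z')" by (simp add: algebra_simps)
  then show "a * x + b * y + c * z = 0" using 1(2) by simp
qed (use assms in \<open>unfold proj_line_def, blast\<close>)

lemma proj_line_scale:
  assumes "k \<noteq> 0"
  shows "proj_line (k * a) (k * b) (k * c) = proj_line a b c"
proof -
  have "k * a * x + k * b * y + k * c * z = k * (a * x + b * y + c * z)" for x y z
    by (simp add: algebra_simps)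
  then show ?thesis using assms unfolding proj_line_def by simp
qed

text \<open>Passing through \<open>[1:0:0]\<close> forces \<open>a = 0\<close>, and
  \<open>b = 0\<close> would leave only the line at infinity.\<close>

lemma horizontal_line_cases:
  assumes "complex_line L" "L \<noteq> line_at_infinity" "proj_point 1 0 0 \<in> L"
  obtains k where "L = proj_line 0 1 (- k)"
proof -
  obtain a b c where abc: "(a, b, c) \<noteq> (0, 0, 0)" "L = proj_line a b c"
    using assms(1) unfolding complex_line_def by blast
  have a: "a = 0" using assms(3) unfolding abc by (simp add: proj_point_in_proj_line_iff)
  have b: "b \<noteq> 0"
    using proj_line_scale[of c 0 0 1] assms(2) a abc by (auto simp: line_at_infinity_def)
  have "L = proj_line 0 1 (- (- c / b))" using proj_line_scale[of b 0 1 "c / b"] a b abc(2) by simp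
  then show thesis by (rule that)
qed

lemma vertical_line_cases:
  assumes "complex_line L" "L \<noteq> line_at_infinity" "proj_point 0 1 0 \<in> L"
  obtains k where "L = proj_line 1 0 (- k)"
proof -
  obtain a b c where abc: "(a, b, c) \<noteq> (0, 0, 0)" "L = proj_line a b c"
    using assms(1) unfolding complex_line_def by blast
  have b: "b = 0" using assms(3) unfolding abc by (simp add: proj_point_in_proj_line_iff)
  have a: "a \<noteq> 0"
    using proj_line_scale[of c 0 0 1] assms(2) b abc by (auto simp: line_at_infinity_def)
  have "L = proj_line 1 0 (- (- c / a))" using proj_line_scale[of a 1 0 "c / a"] a b abc(2) by simp
  then show thesis by (rule that)
qed

lemma in_range_affine_embedding:
  assumes "z \<noteq> 0"
  shows "proj_point x y z \<in> range affine_embedding"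
proof -
  have "affine_embedding (x / z, y / z) = proj_point x y z"
    using proj_point_divide[OF assms, of x y z] assms by (simp add: affine_embedding_def)
  then show ?thesis by (metis rangeI)
qed

text \<open>For \<open>y = k\<close> the cubic condition is linear in \<open>x\<close>, and its
  solution is the mirror image of \<open>cnj k\<close> in the tangent at \<open>t\<close>. Since
  \<open>pr_plane\<close> averages \<open>x\<close> with \<open>cnj k\<close>, it yields the
  foot.\<close>

lemma pedal_curve_of_horizontal_line:
  fixes k :: complex
  defines "L \<equiv> proj_line 0 1 (- k)"
  shows "affine_embedding -` L \<inter> euclidean_plane = {(cnj k, k)}"
    and "julia_set deltoid_map \<inter> L \<subseteq> range affine_embedding"
    and "pr_plane ` (affine_embedding -` (julia_set deltoid_map \<inter> L)) =
      pedal_curve deltoid (sphere 0 1) (cnj k, k)"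
proof -
  have aff: "affine_embedding (x, y) \<in> L \<longleftrightarrow> y = k" for x y
    by (simp add: L_def affine_embedding_def proj_point_in_proj_line_iff)
  then show "affine_embedding -` L \<inter> euclidean_plane = {(cnj k, k)}"
    by (auto simp: euclidean_plane_def)
  show "julia_set deltoid_map \<inter> L \<subseteq> range affine_embedding"
  proof
    fix p assume p: "p \<in> julia_set deltoid_map \<inter> L"
    obtain x y z where xyz: "(x, y, z) \<noteq> (0, 0, 0)" "p = proj_point x y z" by (rule proj_point_cases)
    \<comment> \<open>The only point of \<open>L\<close> at infinity belongs to the attracting cycle
      and hence to the Fatou set.\<close>
    have "z \<noteq> 0"
    proof
      assume z: "z = 0"
      then have "y = 0" "x \<noteq> 0" using p xyz by (auto simp: L_def proj_point_in_proj_line_iff)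
      then have "p = proj_point 1 0 0" using proj_point_divide[of x x 0 0] xyz z by simp
      then show False using p deltoid_cycle_in_fatou by (simp add: julia_set_def)
    qed
    then show "p \<in> range affine_embedding" using xyz(2) in_range_affine_embedding by simp
  qed
  have root: "t ^ 3 - x * t\<^sup>2 + k * t - 1 = 0 \<longleftrightarrow> x = cnj t * k + t - (cnj t)\<^sup>2" if "t \<in> sphere 0 1" for t x
  proof -
    have "t * cnj t = 1" using that by (simp flip: complex_norm_square)
    then show ?thesis by algebra
  qed
  have "affine_embedding -` (julia_set deltoid_map \<inter> L) = (\<lambda>t. (cnj t * k + t - (cnj t)\<^sup>2, k)) ` sphere 0 1"
    using aff root by (fastforce simp: affine_embedding_def affine_julia_iff)
  then show "pr_plane ` (affine_embedding -` (julia_set deltoid_map \<inter> L)) =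
      pedal_curve deltoid (sphere 0 1) (cnj k, k)"
    using pedal_curve_deltoid[of "cnj k"]
    by (simp add: image_image pr_plane_def Let_def algebra_simps)
qed

text \<open>Here the cubic condition is solved for \<open>y\<close>, whose conjugate is the mirror
  image of \<open>k\<close> in the tangent at \<open>t\<close>.\<close>

lemma pedal_curve_of_vertical_line:
  fixes k :: complex
  defines "L \<equiv> proj_line 1 0 (- k)"
  shows "affine_embedding -` L \<inter> euclidean_plane = {(k, cnj k)}"
    and "julia_set deltoid_map \<inter> L \<subseteq> range affine_embedding"
    and "pr_plane ` (affine_embedding -` (julia_set deltoid_map \<inter> L)) =
      pedal_curve deltoid (sphere 0 1) (k, cnj k)"
proof -
  have aff: "affine_embedding (x, y) \<in> L \<longleftrightarrow> x = k" for x y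
    by (simp add: L_def affine_embedding_def proj_point_in_proj_line_iff)
  then show "affine_embedding -` L \<inter> euclidean_plane = {(k, cnj k)}"
    by (auto simp: euclidean_plane_def)
  show "julia_set deltoid_map \<inter> L \<subseteq> range affine_embedding"
  proof
    fix p assume p: "p \<in> julia_set deltoid_map \<inter> L"
    obtain x y z where xyz: "(x, y, z) \<noteq> (0, 0, 0)" "p = proj_point x y z" by (rule proj_point_cases)
    have "z \<noteq> 0"
    proof
      assume z: "z = 0"
      then have "x = 0" "y \<noteq> 0" using p xyz by (auto simp: L_def proj_point_in_proj_line_iff)
      then have "p = proj_point 0 1 0" using proj_point_divide[of y 0 y 0] xyz z by simp
      then show False using p deltoid_cycle_in_fatou by (simp add: julia_set_def)
    qed
    then show "p \<in> range affine_embedding" using xyz(2) in_range_affine_embedding by simp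
  qed
  have root: "t ^ 3 - k * t\<^sup>2 + y * t - 1 = 0 \<longleftrightarrow> y = t * k + cnj t - t\<^sup>2" if "t \<in> sphere 0 1" for t y
  proof -
    have "t * cnj t = 1" using that by (simp flip: complex_norm_square)
    then show ?thesis by algebra
  qed
  have "affine_embedding -` (julia_set deltoid_map \<inter> L) = (\<lambda>t. (k, t * k + cnj t - t\<^sup>2)) ` sphere 0 1"
    using aff root by (fastforce simp: affine_embedding_def affine_julia_iff)
  then show "pr_plane ` (affine_embedding -` (julia_set deltoid_map \<inter> L)) =
      pedal_curve deltoid (sphere 0 1) (k, cnj k)"
    using pedal_curve_deltoid[of k]
    by (simp add: image_image pr_plane_def Let_def algebra_simps)
qed

theorem theorem1:
  shows
    "(\<forall>L. complex_line L \<and> L \<noteq> line_at_infinity \<and> proj_point 1 0 0 \<in> L \<longrightarrow>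
        (\<exists>pt. affine_embedding -` L \<inter> euclidean_plane = {pt} \<and>
          julia_set deltoid_map \<inter> L \<subseteq> range affine_embedding \<and>
          pr_plane ` (affine_embedding -` (julia_set deltoid_map \<inter> L)) =
            pedal_curve deltoid (sphere 0 1) pt)) \<and>
     (\<forall>L. complex_line L \<and> L \<noteq> line_at_infinity \<and> proj_point 0 1 0 \<in> L \<longrightarrow>
        (\<exists>pt. affine_embedding -` L \<inter> euclidean_plane = {pt} \<and>
          julia_set deltoid_map \<inter> L \<subseteq> range affine_embedding \<and>
          pr_plane ` (affine_embedding -` (julia_set deltoid_map \<inter> L)) =
            pedal_curve deltoid (sphere 0 1) pt))"
proof (intro conjI allI impI; elim conjE)
  fix L
  assume "complex_line L" "L \<noteq> line_at_infinity" "proj_point 1 0 0 \<in> L"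
  then obtain k where "L = proj_line 0 1 (- k)" by (rule horizontal_line_cases)
  then show "\<exists>pt. affine_embedding -` L \<inter> euclidean_plane = {pt} \<and>
      julia_set deltoid_map \<inter> L \<subseteq> range affine_embedding \<and>
      pr_plane ` (affine_embedding -` (julia_set deltoid_map \<inter> L)) = pedal_curve deltoid (sphere 0 1) pt"
    using pedal_curve_of_horizontal_line[of k] by blast
next
  fix L
  assume "complex_line L" "L \<noteq> line_at_infinity" "proj_point 0 1 0 \<in> L"
  then obtain k where "L = proj_line 1 0 (- k)" by (rule vertical_line_cases)
  then show "\<exists>pt. affine_embedding -` L \<inter> euclidean_plane = {pt} \<and>
      julia_set deltoid_map \<inter> L \<subseteq> range affine_embedding \<and>
      pr_plane ` (affine_embedding -` (julia_set deltoid_map \<inter> L)) = pedal_curve deltoid (sphere 0 1) pt"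
    using pedal_curve_of_vertical_line[of k] by blast
qed

end
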